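(* Let $m$ be a positive integer, let $G$ be an $m$-tree-connected graph, let $h$ be an integer-valued function on $V(G)$, and let $M$ be a factor of $G$ with $\Delta(M)\le m$. If $H$ is a minimally $m$-tree-connected factor of $G$ containing $M$ having the minimum total excess from $h$ among all such factors, then there exists a subset $S$ of $V(G)$ such that: (1) $\Omega_m(G\setminus S)=\Omega_m(H\setminus S)$; (2) $S\supseteq \{v\in V(G):d_H(v)> h(v)\}$; (3) for each vertex $v\in S$, $d_H(v)\ge h(v)$.
   Context: Graphs are finite, loopless, and may have multiple edges. A factor is a spanning subgraph. A graph is $m$-tree-connected if it contains $m$ pairwise edge-disjoint spanning trees (a one-vertex graph is $m$-tree-connected); it is minimally $m$-tree-connected if it is $m$-tree-connected and deleting any edge destroys this (equivalently, it is $m$-tree-connected with exactly $m(|V|-1)$ edges). The total excess of $H$ from $h$ is $te(H,h)=\sum_{v\in V(H)}\max\{0,d_H(v)-h(v)\}$. The $m$-tree-connected components of a graph are its maximal induced $m$-tree-connected subgraphs; their vertex sets partition the vertex set. For a partition $P$ of $V(G)$, $e_G(P)$ is the number of edges with ends in different parts; $\Omega_m(G)=m|P|-e_G(P)$ for $P$ the partition into vertex sets of the $m$-tree-connected components (and $\Omega_m=0$ for the graph with no vertices). $G\setminus S$ denotes deletion of the vertices of $S$. *)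

theory Defs
  imports Main
begin

text \<open>Only the values of \<open>mends\<close> on \<open>medges\<close> are relevant.\<close>

record ('v, 'e) mgraph =
  mverts :: "'v set"
  medges :: "'e set"
  mends :: "'e \<Rightarrow> 'v set"

definition multigraph :: "('v, 'e) mgraph \<Rightarrow> bool" where
  "multigraph G \<longleftrightarrow> finite (mverts G) \<and> finite (medges G) \<and>
     (\<forall>e \<in> medges G. mends G e \<subseteq> mverts G \<and> card (mends G e) = 2)"

definition msubgraph :: "('v, 'e) mgraph \<Rightarrow> ('v, 'e) mgraph \<Rightarrow> bool" where
  "msubgraph H G \<longleftrightarrow> mverts H \<subseteq> mverts G \<and> medges H \<subseteq> medges G \<and>
     (\<forall>e \<in> medges H. mends H e = mends G e \<and> mends H e \<subseteq> mverts H)"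

definition mfactor :: "('v, 'e) mgraph \<Rightarrow> ('v, 'e) mgraph \<Rightarrow> bool" where
  "mfactor H G \<longleftrightarrow> msubgraph H G \<and> mverts H = mverts G"

definition edge_factor :: "('v, 'e) mgraph \<Rightarrow> 'e set \<Rightarrow> ('v, 'e) mgraph" where
  "edge_factor G F = G\<lparr>medges := F\<rparr>"

definition minduced :: "('v, 'e) mgraph \<Rightarrow> 'v set \<Rightarrow> ('v, 'e) mgraph" where
  "minduced G X = G\<lparr>mverts := X, medges := {e \<in> medges G. mends G e \<subseteq> X}\<rparr>"

definition mdelete_verts :: "('v, 'e) mgraph \<Rightarrow> 'v set \<Rightarrow> ('v, 'e) mgraph" where
  "mdelete_verts G S = minduced G (mverts G - S)"

definition mdelete_edge :: "('v, 'e) mgraph \<Rightarrow> 'e \<Rightarrow> ('v, 'e) mgraph" where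
  "mdelete_edge G e = edge_factor G (medges G - {e})"

definition mdegree :: "('v, 'e) mgraph \<Rightarrow> 'v \<Rightarrow> nat" where
  "mdegree G v = card {e \<in> medges G. v \<in> mends G e}"

definition max_mdegree :: "('v, 'e) mgraph \<Rightarrow> nat" where
  "max_mdegree G = Max (mdegree G ` mverts G)"

definition madjacent :: "('v, 'e) mgraph \<Rightarrow> ('v \<times> 'v) set" where
  "madjacent G = {(u, v). \<exists>e \<in> medges G. mends G e = {u, v}}"

definition mconnected :: "('v, 'e) mgraph \<Rightarrow> bool" where
  "mconnected G \<longleftrightarrow> mverts G \<noteq> {} \<and>
     (\<forall>u \<in> mverts G. \<forall>v \<in> mverts G. (u, v) \<in> (madjacent G)\<^sup>*)"

text \<open>A cycle runs through the distinct vertices \<open>us\<close> and the distinct edges \<open>es\<close>, where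
  \<open>es ! i\<close> joins \<open>us ! i\<close> to its cyclic successor. Two parallel edges form a cycle of length 2.\<close>

definition mcycle :: "('v, 'e) mgraph \<Rightarrow> 'v list \<Rightarrow> 'e list \<Rightarrow> bool" where
  "mcycle G us es \<longleftrightarrow> length us \<ge> 2 \<and> length es = length us \<and> distinct us \<and> distinct es \<and>
     set us \<subseteq> mverts G \<and> set es \<subseteq> medges G \<and>
     (\<forall>i < length us. mends G (es ! i) = {us ! i, us ! (Suc i mod length us)})"

definition mtree :: "('v, 'e) mgraph \<Rightarrow> bool" where
  "mtree T \<longleftrightarrow> mconnected T \<and> \<not> (\<exists>us es. mcycle T us es)"

text \<open>The spanning trees are given as an indexed family of edge sets, so that in the one-vertex
  graph the edgeless spanning tree may be repeated \<open>m\<close> times. The graph without vertices is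
  not \<open>m\<close>-tree-connected for \<open>m > 0\<close>.\<close>

definition tree_connected :: "nat \<Rightarrow> ('v, 'e) mgraph \<Rightarrow> bool" where
  "tree_connected m G \<longleftrightarrow>
     (\<exists>F :: nat \<Rightarrow> 'e set.
        (\<forall>i < m. F i \<subseteq> medges G \<and> mtree (edge_factor G (F i))) \<and>
        (\<forall>i < m. \<forall>j < m. i \<noteq> j \<longrightarrow> F i \<inter> F j = {}))"

definition minimally_tree_connected :: "nat \<Rightarrow> ('v, 'e) mgraph \<Rightarrow> bool" where
  "minimally_tree_connected m G \<longleftrightarrow>
     tree_connected m G \<and> (\<forall>e \<in> medges G. \<not> tree_connected m (mdelete_edge G e))"

definition total_excess :: "('v, 'e) mgraph \<Rightarrow> ('v \<Rightarrow> int) \<Rightarrow> int" where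
  "total_excess H h = (\<Sum>v \<in> mverts H. max 0 (int (mdegree H v) - h v))"

text \<open>Components are represented by their vertex sets; an induced subgraph is determined by its
  vertex set.\<close>

definition tree_components :: "nat \<Rightarrow> ('v, 'e) mgraph \<Rightarrow> 'v set set" where
  "tree_components m G =
     {X. X \<subseteq> mverts G \<and> tree_connected m (minduced G X) \<and>
         (\<forall>Y. X \<subset> Y \<and> Y \<subseteq> mverts G \<longrightarrow> \<not> tree_connected m (minduced G Y))}"

definition crossing_edges :: "('v, 'e) mgraph \<Rightarrow> 'v set set \<Rightarrow> nat" where
  "crossing_edges G P =
     card {e \<in> medges G. \<exists>X \<in> P. \<exists>Y \<in> P. X \<noteq> Y \<and> mends G e \<inter> X \<noteq> {} \<and> mends G e \<inter> Y \<noteq> {}}"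

text \<open>For \<open>m > 0\<close> the graph without vertices has no components, so its value is \<open>0\<close>.\<close>

definition Omega :: "nat \<Rightarrow> ('v, 'e) mgraph \<Rightarrow> int" where
  "Omega m G = int m * int (card (tree_components m G))
     - int (crossing_edges G (tree_components m G))"

end

theory Submission
  imports Defs
begin

text \<open>
  Let \<open>S\<^sub>0\<close> be the set of vertices whose degree in \<open>H\<close> exceeds \<open>h\<close>. From \<open>S\<^sub>k\<close> obtain \<open>S\<^sub>k\<^sub>+\<^sub>1\<close> by
  adding every vertex \<open>v\<close> whose degree cannot be pushed below \<open>h v\<close> by re-choosing the edges of \<open>H\<close>
  inside the component \<open>X\<close> of \<open>v\<close> in \<open>H \<setminus> S\<^sub>k\<close> without creating excess in \<open>X\<close>; let \<open>S\<close> be the limit.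
  Suppose an edge \<open>xy\<close> of \<open>G\<close> outside \<open>H\<close> joins different components of \<open>H \<setminus> S\<^sub>k\<close> and
  \<open>x, y \<notin> S\<^sub>k\<^sub>+\<^sub>1\<close>, with \<open>k\<close> minimal. Re-choose the two components so that \<open>x\<close> and \<open>y\<close> have room for one
  more edge. Adding \<open>xy\<close> then allows the deletion of an edge outside \<open>M\<close> at some \<open>z \<in> S\<^sub>k\<close>, as the
  circuit of \<open>xy\<close> in the \<open>m\<close>-fold union of the graphic matroid gives \<open>z\<close> degree at least \<open>m + 1\<close>.
  For \<open>k = 0\<close> this contradicts the minimality of the total excess, and for \<open>k > 0\<close> the choice
  of \<open>z \<in> S\<^sub>k - S\<^sub>k\<^sub>-\<^sub>1\<close>. So all edges of \<open>G \<setminus> S\<close> between components of \<open>H \<setminus> S\<close> belong to \<open>H\<close>.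
\<close>

subsection \<open>Connectivity and forests\<close>

text \<open>Fusing the two values \<open>f a\<close> and \<open>f b\<close> loses one value. The new
  value \<open>d\<close> must be fresh, since it could otherwise coincide with a third value that
  survives.\<close>

lemma card_image_merge:
  assumes "finite W" "a \<in> W" "b \<in> W" "f a \<noteq> f b" "d \<notin> f ` W"
    and g: "\<And>v. g v = (if f v = f a \<or> f v = f b then d else f v)"
  shows "card (g ` W) + 1 = card (f ` W)"
proof -
  have "g ` W = insert d (f ` W - {f a, f b})"
  proof (intro equalityI subsetI)
    fix c assume "c \<in> g ` W"
    then show "c \<in> insert d (f ` W - {f a, f b})" using g by auto
  next
    fix c assume "c \<in> insert d (f ` W - {f a, f b})"
    then consider "c = d" | v where "v \<in> W" "f v \<noteq> f a" "f v \<noteq> f b" "c = f v"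
      by blast
    then show "c \<in> g ` W"
    proof cases
      case 1
      then have "c = g a" using g by simp
      then show ?thesis using assms(2) by blast
    next
      case 2
      then have "c = g v" using g by simp
      then show ?thesis using 2(1) by blast
    qed
  qed
  then have "card (g ` W) = Suc (card (f ` W - {f a, f b}))"
    using assms(1,5) by (simp add: card_insert_if)
  moreover have "card (f ` W - {f a, f b}) = card (f ` W) - 2"
    using assms(2,3,4) by (subst card_Diff_subset) auto
  moreover have "card (f ` W) \<ge> 2"
    using card_mono [of "f ` W" "{f a, f b}"] assms(1-4) by auto
  ultimately show ?thesis by simp
qed

locale tree_packing =
  fixes V :: "'v set" and E :: "'e set" and ends :: "'e \<Rightarrow> 'v set" and m :: nat
  assumes finite_V: "finite V"
    and finite_E: "finite E"
    and ends_V: "e \<in> E \<Longrightarrow> ends e \<subseteq> V"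
    and card_ends: "e \<in> E \<Longrightarrow> card (ends e) = 2"
    and m_pos: "m > 0"
begin

definition conn :: "'e set \<Rightarrow> ('v \<times> 'v) set" where
  "conn F = {(u, v). \<exists>e \<in> F. ends e = {u, v}}\<^sup>*"

lemma conn_refl [simp]: "(u, u) \<in> conn F"
  by (simp add: conn_def)

lemma conn_trans [trans]: "(u, v) \<in> conn F \<Longrightarrow> (v, w) \<in> conn F \<Longrightarrow> (u, w) \<in> conn F"
  by (simp add: conn_def)

lemma conn_sym: "(u, v) \<in> conn F \<Longrightarrow> (v, u) \<in> conn F"
proof -
  have "sym {(u, v). \<exists>e \<in> F. ends e = {u, v}}"
    by (auto simp: sym_def insert_commute)
  then have "sym (conn F)"
    unfolding conn_def by (rule sym_rtrancl)
  then show "(u, v) \<in> conn F \<Longrightarrow> (v, u) \<in> conn F"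
    by (auto dest: symD)
qed

lemma conn_mono: "F \<subseteq> F' \<Longrightarrow> conn F \<subseteq> conn F'"
  unfolding conn_def by (rule rtrancl_mono) blast

lemma conn_edge: "e \<in> F \<Longrightarrow> ends e = {u, v} \<Longrightarrow> (u, v) \<in> conn F"
  unfolding conn_def by blast

lemma conn_subsetI:
  assumes "\<And>e u v. e \<in> F \<Longrightarrow> ends e = {u, v} \<Longrightarrow> (u, v) \<in> conn F'"
  shows "conn F \<subseteq> conn F'"
  using assms unfolding conn_def by (intro rtrancl_subset_rtrancl) blast

lemma conn_empty: "(u, v) \<in> conn {} \<longleftrightarrow> u = v"
  by (simp add: conn_def)

lemma conn_closed:
  assumes "(u, v) \<in> conn F" "u \<in> U"
    and "\<And>e a b. e \<in> F \<Longrightarrow> ends e = {a, b} \<Longrightarrow> a \<in> U \<Longrightarrow> b \<in> U"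
  shows "v \<in> U"
  using assms(1) unfolding conn_def
  by (induction rule: rtrancl_induct) (use assms(2,3) in blast)+

lemma conn_first_edge:
  assumes "(u, v) \<in> conn F" "u \<noteq> v"
  shows "\<exists>e \<in> F. u \<in> ends e"
  using assms(1) unfolding conn_def
  by (cases rule: converse_rtranclE) (use assms(2) in auto)

text \<open>A walk needs the edge \<open>e\<close> at most once: in the induction along the walk, a
  second passage through \<open>e\<close> cancels the first.\<close>

lemma conn_insert_cases:
  assumes "ends e = {a, b}" "(u, v) \<in> conn (insert e F)"
  shows "(u, v) \<in> conn F \<or> (u, a) \<in> conn F \<and> (b, v) \<in> conn F
    \<or> (u, b) \<in> conn F \<and> (a, v) \<in> conn F"
  using assms(2) unfolding conn_def [of "insert e F"]
proof (induction rule: rtrancl_induct)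
  case base
  show ?case by simp
next
  case (step v w)
  then obtain f where f: "f \<in> insert e F" "ends f = {v, w}" by auto
  show ?case
  proof (cases "f \<in> F")
    case True
    then have "(v, w) \<in> conn F" using f conn_edge by blast
    then show ?thesis using step.IH by (meson conn_trans)
  next
    case False
    then have "{v, w} = {a, b}" using f assms(1) by auto
    then show ?thesis using step.IH by (metis conn_refl conn_sym conn_trans doubleton_eq_iff)
  qed
qed

lemma conn_insert_same:
  assumes "ends e = {a, b}" "(a, b) \<in> conn F"
  shows "conn (insert e F) = conn F"
proof
  show "conn (insert e F) \<subseteq> conn F"
  proof (rule subrelI)
    fix u v assume "(u, v) \<in> conn (insert e F)"
    from conn_insert_cases [OF assms(1) this] show "(u, v) \<in> conn F"
      using assms(2) by (meson conn_sym conn_trans)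
  qed
qed (rule conn_mono, blast)

section \<open>Counting the connectivity classes that meet a vertex set\<close>

definition num_classes :: "'v set \<Rightarrow> 'e set \<Rightarrow> nat" where
  "num_classes W F = card ((\<lambda>v. conn F `` {v}) ` W)"

lemma class_eq_iff: "conn F `` {u} = conn F `` {v} \<longleftrightarrow> (u, v) \<in> conn F"
  by (auto intro: conn_trans conn_sym)

lemma num_classes_insert:
  assumes "finite W" "ends e = {a, b}" "a \<in> W" "b \<in> W" "(a, b) \<notin> conn F"
  shows "num_classes W (insert e F) + 1 = num_classes W F"
proof -
  let ?c = "\<lambda>v. conn F `` {v}"
  let ?c' = "\<lambda>v. conn (insert e F) `` {v}"
  have sub: "conn F \<subseteq> conn (insert e F)" by (rule conn_mono) blast
  have ab: "(a, b) \<in> conn (insert e F)" using assms(2) conn_edge by blast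
  have joined: "?c' a = ?c a \<union> ?c b"
  proof
    show "?c' a \<subseteq> ?c a \<union> ?c b" using conn_insert_cases [OF assms(2)] by auto
    show "?c a \<union> ?c b \<subseteq> ?c' a" using sub ab by (auto intro: conn_trans)
  qed
  have c': "?c' v = (if ?c v = ?c a \<or> ?c v = ?c b then ?c a \<union> ?c b else ?c v)" for v
  proof (cases "?c v = ?c a \<or> ?c v = ?c b")
    case True
    then have "(v, a) \<in> conn (insert e F)"
      unfolding class_eq_iff using sub ab by (meson conn_sym conn_trans subsetD)
    then have "?c' v = ?c' a" by (simp add: class_eq_iff)
    with True joined show ?thesis by simp
  next
    case False
    then have "(v, a) \<notin> conn F" "(v, b) \<notin> conn F" unfolding class_eq_iff by blast+
    then have "?c' v \<subseteq> ?c v" using conn_insert_cases [OF assms(2), of v] by auto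
    moreover have "?c v \<subseteq> ?c' v" using sub by auto
    ultimately show ?thesis using False by (simp only: if_False simp_thms subset_antisym)
  qed
  \<comment> \<open>An old class containing both \<open>a\<close> and \<open>b\<close> would connect
    them already.\<close>
  have new: "?c a \<union> ?c b \<notin> ?c ` W"
  proof
    assume "?c a \<union> ?c b \<in> ?c ` W"
    then obtain v where v: "?c a \<union> ?c b = ?c v" by blast
    then have "a \<in> ?c v" "b \<in> ?c v" by (metis ImageI UnI1 UnI2 conn_refl singletonI)+
    then show False using assms(5) by (auto intro: conn_trans conn_sym)
  qed
  have ne: "?c a \<noteq> ?c b" using assms(5) by (simp only: class_eq_iff simp_thms)
  show ?thesis
    unfolding num_classes_def by (rule card_image_merge [OF assms(1,3,4) ne new c'])
qed

lemma num_classes_empty: "num_classes W {} = card W"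
  unfolding num_classes_def
  by (rule card_image) (auto simp: inj_on_def class_eq_iff conn_empty)

text \<open>Acyclicity in the form that every edge is a bridge; the link to cycles is
  \<open>forest_no_mcycle\<close>.\<close>

definition forest :: "'e set \<Rightarrow> bool" where
  "forest F \<longleftrightarrow> (\<forall>e \<in> F. \<forall>u v. ends e = {u, v} \<longrightarrow> (u, v) \<notin> conn (F - {e}))"

lemma forest_subset: "forest F \<Longrightarrow> F' \<subseteq> F \<Longrightarrow> forest F'"
  unfolding forest_def by (meson Diff_mono conn_mono subsetD subset_refl)

lemma ends_pair:
  assumes "e \<in> E"
  obtains u v where "ends e = {u, v}" "u \<noteq> v"
  using card_ends [OF assms] by (auto simp: card_2_iff)

text \<open>Without edges there are \<open>card W\<close> classes, and each further edge merges at
  most two of them.\<close>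

lemma num_classes_bound:
  assumes "finite W" "F \<subseteq> E" "\<forall>e \<in> F. ends e \<subseteq> W"
  shows "card W \<le> num_classes W F + card F"
proof -
  have "finite F" using assms(2) finite_E finite_subset by blast
  then show ?thesis using assms(2,3)
  proof (induction F)
    case empty
    then show ?case by (simp add: num_classes_empty)
  next
    case (insert e F)
    obtain u v where uv: "ends e = {u, v}"
      by (rule ends_pair [of e]) (use insert.prems in auto)
    have le: "num_classes W F \<le> num_classes W (insert e F) + 1"
    proof (cases "(u, v) \<in> conn F")
      case True
      then show ?thesis using conn_insert_same [OF uv] by (simp add: num_classes_def)
    next
      case False
      then show ?thesis using num_classes_insert [OF assms(1) uv] insert.prems uv by simp
    qed
    then show ?case using insert by simp
  qed
qed

text \<open>In a forest each edge merges two classes when it is added, so the bound of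
  \<open>num_classes_bound\<close> is attained.\<close>

lemma num_classes_forest:
  assumes "finite W" "F \<subseteq> E" "\<forall>e \<in> F. ends e \<subseteq> W" "forest F"
  shows "num_classes W F + card F = card W"
proof -
  have "finite F" using assms(2) finite_E finite_subset by blast
  then show ?thesis using assms(2-4)
  proof (induction F)
    case empty
    then show ?case by (simp add: num_classes_empty)
  next
    case (insert e F)
    obtain u v where uv: "ends e = {u, v}"
      by (rule ends_pair [of e]) (use insert.prems in auto)
    have "(u, v) \<notin> conn F"
      using insert.prems(3) insert.hyps(2) uv unfolding forest_def by (metis Diff_insert_absorb insertI1)
    then have "num_classes W (insert e F) + 1 = num_classes W F"
      using num_classes_insert [OF assms(1) uv] insert.prems uv by simp
    moreover have "forest F" using insert.prems(3) forest_subset by blast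
    ultimately show ?case using insert by simp
  qed
qed

lemma num_classes_pos: "finite W \<Longrightarrow> W \<noteq> {} \<Longrightarrow> num_classes W F \<ge> 1"
  by (simp add: num_classes_def card_gt_0_iff Suc_le_eq)

section \<open>Connected spanning edge sets and their sizes\<close>

definition spans :: "'v set \<Rightarrow> 'e set \<Rightarrow> bool" where
  "spans X F \<longleftrightarrow> (\<forall>e \<in> F. ends e \<subseteq> X) \<and> (\<forall>u \<in> X. \<forall>v \<in> X. (u, v) \<in> conn F)"

lemma num_classes_spans:
  assumes "spans X F" "X \<noteq> {}"
  shows "num_classes X F = 1"
proof -
  obtain x where x: "x \<in> X" using assms(2) by blast
  have "(\<lambda>v. conn F `` {v}) ` X = {conn F `` {x}}"
    using x assms(1) class_eq_iff unfolding spans_def by blast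
  then show ?thesis by (simp add: num_classes_def)
qed

lemma spans_if_num_classes:
  assumes "num_classes X F \<le> 1" "finite X" "\<forall>e \<in> F. ends e \<subseteq> X"
  shows "spans X F"
  unfolding spans_def
proof (intro conjI ballI)
  fix u v assume "u \<in> X" "v \<in> X"
  then have *: "conn F `` {u} \<in> (\<lambda>v. conn F `` {v}) ` X" "conn F `` {v} \<in> (\<lambda>v. conn F `` {v}) ` X"
    by simp_all
  have "card ((\<lambda>v. conn F `` {v}) ` X) \<le> Suc 0"
    using assms(1) by (simp add: num_classes_def)
  then have "\<forall>C \<in> (\<lambda>v. conn F `` {v}) ` X. \<forall>D \<in> (\<lambda>v. conn F `` {v}) ` X. C = D"
    by (simp only: card_le_Suc0_iff_eq finite_imageI [OF assms(2)])
  then have "conn F `` {u} = conn F `` {v}" using * by (meson bspec)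
  then show "(u, v) \<in> conn F" by (simp only: class_eq_iff)
qed (use assms(3) in auto)

lemma card_forest:
  assumes "finite X" "X \<noteq> {}" "F \<subseteq> E" "\<forall>e \<in> F. ends e \<subseteq> X" "forest F"
  shows "card F \<le> card X - 1"
  using num_classes_forest [OF assms(1,3,4,5)] num_classes_pos [OF assms(1,2), of F]
  by linarith

lemma forest_spans_card:
  assumes "finite X" "X \<noteq> {}" "F \<subseteq> E" "spans X F" "forest F"
  shows "card F = card X - 1"
  using num_classes_forest [of X F] num_classes_spans [of X F] assms by (auto simp: spans_def)

lemma spans_card_ge:
  assumes "finite X" "X \<noteq> {}" "F \<subseteq> E" "spans X F"
  shows "card X - 1 \<le> card F"
  using num_classes_bound [of X F] num_classes_spans [of X F] assms by (auto simp: spans_def)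

lemma spans_card_forest:
  assumes "finite X" "X \<noteq> {}" "F \<subseteq> E" "spans X F" "card F \<le> card X - 1"
  shows "forest F"
  unfolding forest_def
proof (intro ballI allI impI notI)
  fix e u v assume e: "e \<in> F" "ends e = {u, v}" "(u, v) \<in> conn (F - {e})"
  have "conn (F - {e}) = conn F"
    using conn_insert_same [OF e(2,3)] e(1) by (simp add: insert_absorb)
  then have "spans X (F - {e})" using assms(4) by (auto simp: spans_def)
  then have "card X - 1 \<le> card (F - {e})" 
    using assms(3) by (intro spans_card_ge [OF assms(1,2)]) auto
  moreover have "card (F - {e}) < card F"
    by (rule card_Diff1_less [OF finite_subset [OF assms(3) finite_E] e(1)])
  ultimately show False using assms(5) by simp
qed

text \<open>In an inclusion-minimal connected spanning edge set every edge is a bridge, as any other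
  edge could be dropped.\<close>

lemma spans_contains_forest:
  assumes "F \<subseteq> E" "spans X F"
  shows "\<exists>T \<subseteq> F. spans X T \<and> forest T"
proof -
  let ?S = "{T. T \<subseteq> F \<and> spans X T}"
  have "finite ?S" "F \<in> ?S"
    using finite_subset [OF assms(1) finite_E] assms(2) by auto
  from finite_has_minimal2 [OF this]
  obtain T where T: "T \<in> ?S" and min: "\<forall>T' \<in> ?S. T' \<subseteq> T \<longrightarrow> T = T'"
    by blast
  have "forest T"
    unfolding forest_def
  proof (intro ballI allI impI notI)
    fix e u v assume e: "e \<in> T" "ends e = {u, v}" "(u, v) \<in> conn (T - {e})"
    have "conn (T - {e}) = conn T"
      using conn_insert_same [OF e(2,3)] e(1) by (simp add: insert_absorb)
    then have "spans X (T - {e})" using T by (auto simp: spans_def)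
    then show False using min T e(1) by blast
  qed
  with T show ?thesis by blast
qed

subsection \<open>Packings of spanning trees\<close>

definition ind :: "'e set \<Rightarrow> 'v set \<Rightarrow> 'e set" where
  "ind A X = {e \<in> A. ends e \<subseteq> X}"

definition edge_disjoint :: "(nat \<Rightarrow> 'e set) \<Rightarrow> bool" where
  "edge_disjoint F \<longleftrightarrow> (\<forall>i < m. \<forall>j < m. i \<noteq> j \<longrightarrow> F i \<inter> F j = {})"

text \<open>As \<open>spans X\<close> confines each tree to \<open>X\<close>, the edges of \<open>A\<close> that leave \<open>X\<close> are irrelevant:
  \<open>tcon X A\<close> says that the subgraph of \<open>(V, A)\<close> induced by \<open>X\<close> is \<open>m\<close>-tree-connected.\<close>

definition tcon :: "'v set \<Rightarrow> 'e set \<Rightarrow> bool" where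
  "tcon X A \<longleftrightarrow> X \<noteq> {} \<and> X \<subseteq> V \<and> (\<exists>F. (\<forall>i < m. F i \<subseteq> A \<and> spans X (F i)) \<and> edge_disjoint F)"

definition packing :: "'v set \<Rightarrow> 'e set \<Rightarrow> (nat \<Rightarrow> 'e set) \<Rightarrow> bool" where
  "packing X A F \<longleftrightarrow> (\<forall>i < m. F i \<subseteq> A \<and> spans X (F i) \<and> forest (F i)) \<and> edge_disjoint F"

text \<open>Minimality is encoded by the number of edges, which makes it stable under replacements
  of equal size; \<open>minimally_tree_connected_iff\<close> identifies it with minimality under
  deletion. Unlike in \<open>tcon\<close>, all edges of \<open>A\<close> must lie inside
  \<open>X\<close>.\<close>

definition mtcon :: "'v set \<Rightarrow> 'e set \<Rightarrow> bool" where
  "mtcon X A \<longleftrightarrow> tcon X A \<and> A \<subseteq> E \<and> (\<forall>e \<in> A. ends e \<subseteq> X) \<and> card A = m * (card X - 1)"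

lemma spans_ends: "spans X F \<Longrightarrow> e \<in> F \<Longrightarrow> ends e \<subseteq> X"
  by (simp add: spans_def)

lemma spans_conn: "spans X F \<Longrightarrow> u \<in> X \<Longrightarrow> v \<in> X \<Longrightarrow> (u, v) \<in> conn F"
  by (simp add: spans_def)

lemma edge_disjointI:
  assumes "\<And>i j e. i < m \<Longrightarrow> j < m \<Longrightarrow> i \<noteq> j \<Longrightarrow> e \<in> F i \<Longrightarrow> e \<in> F j \<Longrightarrow> False"
  shows "edge_disjoint F"
  using assms unfolding edge_disjoint_def by blast

lemma edge_disjointD: "edge_disjoint F \<Longrightarrow> i < m \<Longrightarrow> j < m \<Longrightarrow> i \<noteq> j \<Longrightarrow> e \<in> F i \<Longrightarrow> e \<notin> F j"
  unfolding edge_disjoint_def by blast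

lemma tconI:
  assumes "X \<noteq> {}" "X \<subseteq> V" "\<And>i. i < m \<Longrightarrow> F i \<subseteq> A" "\<And>i. i < m \<Longrightarrow> spans X (F i)" "edge_disjoint F"
  shows "tcon X A"
  unfolding tcon_def using assms by (intro conjI exI [of _ F]) auto

lemma tconE:
  assumes "tcon X A"
  obtains F where "\<And>i. i < m \<Longrightarrow> F i \<subseteq> A" "\<And>i. i < m \<Longrightarrow> spans X (F i)" "edge_disjoint F"
  using assms unfolding tcon_def by (auto elim!: exE)

lemma tcon_V: "tcon X A \<Longrightarrow> X \<noteq> {}" "tcon X A \<Longrightarrow> X \<subseteq> V"
  by (simp_all add: tcon_def)

lemma packingI:
  assumes "\<And>i. i < m \<Longrightarrow> F i \<subseteq> A" "\<And>i. i < m \<Longrightarrow> spans X (F i)"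
    "\<And>i. i < m \<Longrightarrow> forest (F i)" "edge_disjoint F"
  shows "packing X A F"
  using assms by (simp add: packing_def)

lemma packingD:
  assumes "packing X A F"
  shows "i < m \<Longrightarrow> F i \<subseteq> A" "i < m \<Longrightarrow> spans X (F i)" "i < m \<Longrightarrow> forest (F i)" "edge_disjoint F"
  using assms by (simp_all add: packing_def)

lemma ind_subset: "ind A X \<subseteq> A"
  by (auto simp: ind_def)

lemma tcon_mono: "tcon X A \<Longrightarrow> A \<subseteq> B \<Longrightarrow> tcon X B"
  unfolding tcon_def by (meson subset_trans)

lemma tcon_ind:
  assumes "tcon X A"
  shows "tcon X (ind A X)"
proof -
  obtain F where F: "\<And>i. i < m \<Longrightarrow> F i \<subseteq> A" "\<And>i. i < m \<Longrightarrow> spans X (F i)" "edge_disjoint F"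
    by (rule tconE [OF assms]) blast
  show ?thesis
  proof (rule tconI [of X F])
    fix i assume i: "i < m"
    show "F i \<subseteq> ind A X"
      using F(1) [OF i] spans_ends [OF F(2) [OF i]] by (auto simp: ind_def)
  qed (use F tcon_V assms in auto)
qed

lemma tcon_singleton: "v \<in> V \<Longrightarrow> tcon {v} A"
  unfolding tcon_def by (auto simp: spans_def edge_disjoint_def intro!: exI [of _ "\<lambda>_. {}"])

text \<open>An edge inside \<open>X\<close> can be bypassed within \<open>T\<close>, since
  \<open>T\<close> connects \<open>X\<close>.\<close>

lemma conn_replace:
  assumes "spans X T" "(u, v) \<in> conn F"
  shows "(u, v) \<in> conn (F - ind F X \<union> T)"
proof -
  have "conn F \<subseteq> conn (F - ind F X \<union> T)"
  proof (rule conn_subsetI)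
    fix e u v assume e: "e \<in> F" "ends e = {u, v}"
    show "(u, v) \<in> conn (F - ind F X \<union> T)"
    proof (cases "ends e \<subseteq> X")
      case True
      then have "(u, v) \<in> conn T" using assms(1) e(2) by (auto simp: spans_def)
      then show ?thesis using conn_mono [of T "F - ind F X \<union> T"] by blast
    next
      case False
      with e show ?thesis by (intro conn_edge [of e]) (auto simp: ind_def)
    qed
  qed
  with assms(2) show ?thesis by blast
qed

lemma tcon_Un:
  assumes "tcon X A" "tcon Y A" "X \<inter> Y \<noteq> {}"
  shows "tcon (X \<union> Y) A"
proof -
  obtain F where F: "\<And>i. i < m \<Longrightarrow> F i \<subseteq> A" "\<And>i. i < m \<Longrightarrow> spans X (F i)" "edge_disjoint F"
    by (rule tconE [OF assms(1)]) blast
  obtain F' where F': "\<And>i. i < m \<Longrightarrow> F' i \<subseteq> A" "\<And>i. i < m \<Longrightarrow> spans Y (F' i)" "edge_disjoint F'"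
    by (rule tconE [OF assms(2)]) blast
  obtain w where w: "w \<in> X" "w \<in> Y" using assms(3) by blast
  \<comment> \<open>The i-th tree on \<open>X\<close>, extended by those edges of the i-th connected
    set on \<open>Y\<close> that are not inside \<open>X\<close>. Dropping the edges inside
    \<open>X\<close> keeps the new sets disjoint for different indices, although an edge may occur
    in both families.\<close>
  define K where "K i = F' i - ind (F' i) X \<union> F i" for i
  show ?thesis
  proof (rule tconI [of _ K])
    fix i assume i: "i < m"
    show "spans (X \<union> Y) (K i)"
      unfolding spans_def
    proof (intro conjI ballI)
      fix e assume "e \<in> K i"
      then show "ends e \<subseteq> X \<union> Y"
        using spans_ends [OF F(2) [OF i]] spans_ends [OF F'(2) [OF i]] by (auto simp: K_def)
    next
      have to_w: "(u, w) \<in> conn (K i)" if "u \<in> X \<union> Y" for u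
      proof (cases "u \<in> X")
        case True
        then have "(u, w) \<in> conn (F i)" using spans_conn [OF F(2) [OF i]] w by blast
        then show ?thesis using conn_mono [of "F i" "K i"] by (auto simp: K_def)
      next
        case False
        then have "(u, w) \<in> conn (F' i)" using that spans_conn [OF F'(2) [OF i]] w by blast
        then show ?thesis unfolding K_def by (rule conn_replace [OF F(2) [OF i]])
      qed
      fix u v assume "u \<in> X \<union> Y" "v \<in> X \<union> Y"
      then show "(u, v) \<in> conn (K i)" using conn_trans [OF to_w conn_sym [OF to_w]] by blast
    qed
    show "K i \<subseteq> A" using F(1) [OF i] F'(1) [OF i] by (auto simp: K_def)
  next
    show "edge_disjoint K"
    proof (rule edge_disjointI)
      fix i j e assume *: "i < m" "j < m" "i \<noteq> j" "e \<in> K i" "e \<in> K j"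
      then show False
        using edge_disjointD [OF F(3) *(1-3), of e] edge_disjointD [OF F'(3) *(1-3), of e]
          spans_ends [OF F(2) [OF *(1)], of e] spans_ends [OF F(2) [OF *(2)], of e]
        by (auto simp: K_def ind_def)
    qed
  qed (use tcon_V assms in auto)
qed

text \<open>In each connected set of a family on \<open>Z\<close> the part inside \<open>X\<close>
  is exchanged for a connected set on \<open>X\<close> from the family in \<open>B\<close>;
  connections through \<open>X\<close> are rerouted by \<open>conn_replace\<close>.\<close>

lemma tcon_replace:
  assumes "tcon Z A" "tcon X B" "X \<subseteq> Z"
  shows "tcon Z (A - ind A X \<union> B)"
proof -
  obtain F where F: "\<And>i. i < m \<Longrightarrow> F i \<subseteq> A" "\<And>i. i < m \<Longrightarrow> spans Z (F i)" "edge_disjoint F"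
    by (rule tconE [OF assms(1)]) blast
  obtain F' where F': "\<And>i. i < m \<Longrightarrow> F' i \<subseteq> B" "\<And>i. i < m \<Longrightarrow> spans X (F' i)" "edge_disjoint F'"
    by (rule tconE [OF assms(2)]) blast
  define K where "K i = F i - ind (F i) X \<union> F' i" for i
  show ?thesis
  proof (rule tconI [of _ K])
    fix i assume i: "i < m"
    show "spans Z (K i)"
      unfolding spans_def
    proof (intro conjI ballI)
      fix e assume "e \<in> K i"
      then show "ends e \<subseteq> Z"
        using spans_ends [OF F(2) [OF i], of e] spans_ends [OF F'(2) [OF i], of e] assms(3)
        by (auto simp: K_def)
    next
      fix u v assume "u \<in> Z" "v \<in> Z"
      then show "(u, v) \<in> conn (K i)"
        unfolding K_def using conn_replace [OF F'(2) [OF i]] spans_conn [OF F(2) [OF i]] by blast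
    qed
    show "K i \<subseteq> A - ind A X \<union> B" using F(1) [OF i] F'(1) [OF i] by (auto simp: K_def ind_def)
  next
    show "edge_disjoint K"
    proof (rule edge_disjointI)
      fix i j e assume *: "i < m" "j < m" "i \<noteq> j" "e \<in> K i" "e \<in> K j"
      then show False
        using edge_disjointD [OF F(3) *(1-3), of e] edge_disjointD [OF F'(3) *(1-3), of e]
          spans_ends [OF F'(2) [OF *(1)], of e] spans_ends [OF F'(2) [OF *(2)], of e]
        by (auto simp: K_def ind_def)
    qed
  qed (use tcon_V assms in auto)
qed

section \<open>Edge counts of packings and of minimally tree-connected sets\<close>

lemma finite_sub_V: "X \<subseteq> V \<Longrightarrow> finite X"
  using finite_V finite_subset by blast

lemma finite_sub_E: "A \<subseteq> E \<Longrightarrow> finite A"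
  using finite_E finite_subset by blast

lemma tcon_packing:
  assumes "tcon X A" "A \<subseteq> E"
  obtains F where "packing X A F"
proof -
  obtain F where F: "\<And>i. i < m \<Longrightarrow> F i \<subseteq> A" "\<And>i. i < m \<Longrightarrow> spans X (F i)" "edge_disjoint F"
    by (rule tconE [OF assms(1)]) blast
  have "\<exists>T \<subseteq> F i. spans X T \<and> forest T" if "i < m" for i
    using F(1,2) [OF that] assms(2) by (intro spans_contains_forest) auto
  then obtain T where T: "\<And>i. i < m \<Longrightarrow> T i \<subseteq> F i \<and> spans X (T i) \<and> forest (T i)"
    by metis
  have "packing X A T"
  proof (rule packingI)
    show "edge_disjoint T"
      using edge_disjointD [OF F(3)] T by (intro edge_disjointI) (meson subsetD)
  qed (use T F(1) in blast)+
  then show ?thesis by (rule that)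
qed

lemma card_Union_disj:
  assumes "edge_disjoint F" "\<And>i. i < m \<Longrightarrow> F i \<subseteq> E"
  shows "card (\<Union>i<m. F i) = (\<Sum>i<m. card (F i))"
  using assms by (intro card_UN_disjoint) (auto simp: edge_disjoint_def finite_sub_E)

lemma card_packing:
  assumes "packing X A F" "A \<subseteq> E" "X \<noteq> {}" "X \<subseteq> V"
  shows "card (\<Union>i<m. F i) = m * (card X - 1)"
proof -
  have "card (F i) = card X - 1" if "i < m" for i
    using assms that by (intro forest_spans_card finite_sub_V) (auto simp: packing_def)
  moreover have "card (\<Union>i<m. F i) = (\<Sum>i<m. card (F i))"
    using assms(1,2) by (intro card_Union_disj) (auto simp: packing_def)
  ultimately show ?thesis by simp
qed

lemma mtcon_packing:
  assumes "mtcon X A"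
  obtains F where "packing X A F" "(\<Union>i<m. F i) = A"
proof -
  have A: "A \<subseteq> E" "tcon X A" using assms by (auto simp: mtcon_def)
  then obtain F where F: "packing X A F" using tcon_packing by blast
  moreover have "(\<Union>i<m. F i) = A"
  proof (rule card_subset_eq)
    show "card (\<Union>i<m. F i) = card A"
      using card_packing [OF F] A assms by (auto simp: tcon_def mtcon_def)
  qed (use F A finite_sub_E in \<open>auto simp: packing_def\<close>)
  ultimately show ?thesis using that by blast
qed

lemma tcon_card_ge:
  assumes "tcon X A" "A \<subseteq> E"
  shows "m * (card X - 1) \<le> card (ind A X)"
proof -
  have sub: "ind A X \<subseteq> E" using assms(2) ind_subset by blast
  then obtain F where F: "packing X (ind A X) F"
    using tcon_packing tcon_ind assms(1) by metis
  have "card (\<Union>i<m. F i) = m * (card X - 1)"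
    using assms(1) by (intro card_packing [OF F sub]) (auto simp: tcon_def)
  moreover have "(\<Union>i<m. F i) \<subseteq> ind A X" using F by (auto simp: packing_def)
  ultimately show ?thesis using sub finite_sub_E by (metis card_mono)
qed

text \<open>By minimality \<open>A\<close> is exactly the union of \<open>m\<close> disjoint
  spanning trees of \<open>Z\<close>. Inside \<open>X\<close> they leave \<open>m\<close> forests
  with at most \<open>card X - 1\<close> edges each; if the total is attained, every one of them is
  a spanning tree of \<open>X\<close>.\<close>

lemma mtcon_card_ind:
  assumes "mtcon Z A" "X \<subseteq> Z" "X \<noteq> {}"
  shows "card (ind A X) \<le> m * (card X - 1)"
    and "card (ind A X) = m * (card X - 1) \<Longrightarrow> tcon X A"
proof -
  obtain F where F: "packing Z A F" "(\<Union>i<m. F i) = A"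
    by (rule mtcon_packing [OF assms(1)])
  have A: "A \<subseteq> E" and XV: "X \<subseteq> V" using assms(1,2) by (auto simp: mtcon_def tcon_def)
  have fX: "finite X" using XV by (rule finite_sub_V)
  define K where "K i = ind (F i) X" for i
  have K: "K i \<subseteq> F i" "\<forall>e \<in> K i. ends e \<subseteq> X" for i by (auto simp: K_def ind_def)
  have KE: "K i \<subseteq> E" if "i < m" for i
    using packingD(1) [OF F(1) that] A K(1) by blast
  have Kf: "forest (K i)" if "i < m" for i
    using packingD(3) [OF F(1) that] K(1) by (rule forest_subset)
  have K_le: "card (K i) \<le> card X - 1" if "i < m" for i
    by (rule card_forest [OF fX assms(3) KE [OF that] K(2) Kf [OF that]])
  have dK: "edge_disjoint K"
    using edge_disjointD [OF packingD(4) [OF F(1)]] K(1) by (intro edge_disjointI) blast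
  have "ind A X = (\<Union>i<m. K i)" using F(2) by (auto simp: K_def ind_def)
  then have card_eq: "card (ind A X) = (\<Sum>i<m. card (K i))"
    using card_Union_disj [OF dK KE] by simp
  have "(\<Sum>i<m. card (K i)) \<le> (\<Sum>i<m. card X - 1)"
    using K_le by (intro sum_mono) auto
  then show "card (ind A X) \<le> m * (card X - 1)" using card_eq by simp
  assume eq: "card (ind A X) = m * (card X - 1)"
  have "card (K i) = card X - 1" if "i < m" for i
  proof (rule ccontr)
    assume "card (K i) \<noteq> card X - 1"
    then have "card (K i) < card X - 1" using K_le [OF that] by simp
    then have "(\<Sum>i<m. card (K i)) < (\<Sum>i<m. card X - 1)"
      using K_le that by (intro sum_strict_mono_ex1) auto
    then show False using eq card_eq by simp
  qed
  then have "num_classes X (K i) \<le> 1" if "i < m" for i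
    using num_classes_forest [OF fX KE [OF that] K(2) Kf [OF that]] that by simp
  then have "spans X (K i)" if "i < m" for i
    using spans_if_num_classes [OF _ fX K(2)] that by blast
  then show "tcon X A"
    using dK K(1) F(2) XV assms(3) by (intro tconI [of X K]) blast+
qed

lemma mtcon_ind:
  assumes "mtcon Z A" "tcon X A" "X \<subseteq> Z"
  shows "mtcon X (ind A X)"
proof -
  have "A \<subseteq> E" "X \<noteq> {}" using assms by (auto simp: mtcon_def tcon_def)
  then have "card (ind A X) = m * (card X - 1)"
    using tcon_card_ge [OF assms(2)] mtcon_card_ind(1) [OF assms(1,3)] by simp
  then show ?thesis
    using tcon_ind [OF assms(2)] \<open>A \<subseteq> E\<close> by (auto simp: mtcon_def ind_def)
qed

text \<open>Both \<open>ind A X\<close> and \<open>B\<close> have \<open>m * (card X - 1)\<close>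
  edges, so the replacement keeps the edge count as well as the tree-connectivity.\<close>

lemma mtcon_replace:
  assumes "mtcon Z A" "mtcon X B" "X \<subseteq> Z" "tcon X A"
  shows "mtcon Z (A - ind A X \<union> B)"
proof -
  have sub: "A \<subseteq> E" "B \<subseteq> E" using assms by (auto simp: mtcon_def)
  have disjoint: "(A - ind A X) \<inter> B = {}" using assms(2) by (auto simp: mtcon_def ind_def)
  have le: "card (ind A X) \<le> card A"
    by (intro card_mono finite_sub_E ind_subset sub)
  have "card (A - ind A X \<union> B) = card (A - ind A X) + card B"
    using disjoint sub by (intro card_Un_disjoint) (auto intro: finite_sub_E)
  also have "card (A - ind A X) = card A - card (ind A X)"
    using sub ind_subset [of A X] by (intro card_Diff_subset) (auto intro: finite_sub_E)
  also have "card B = card (ind A X)"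
    using mtcon_ind [OF assms(1,4,3)] assms(2) by (simp add: mtcon_def)
  finally have "card (A - ind A X \<union> B) = m * (card Z - 1)"
    using le assms(1) by (simp add: mtcon_def)
  moreover have "tcon Z (A - ind A X \<union> B)"
    using assms by (intro tcon_replace) (auto simp: mtcon_def)
  ultimately show ?thesis using assms(1-3) unfolding mtcon_def by blast
qed

text \<open>Each of the \<open>m\<close> disjoint connected sets needs an edge of its own at
  \<open>z\<close> in order to reach \<open>w\<close>.\<close>

lemma tcon_degree_ge:
  assumes "tcon X A" "A \<subseteq> E" "z \<in> X" "w \<in> X" "w \<noteq> z"
  shows "m \<le> card {e \<in> ind A X. z \<in> ends e}"
proof -
  obtain F where F: "\<And>i. i < m \<Longrightarrow> F i \<subseteq> A" "\<And>i. i < m \<Longrightarrow> spans X (F i)" "edge_disjoint F"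
    by (rule tconE [OF assms(1)]) blast
  have "\<exists>e. e \<in> F i \<and> z \<in> ends e" if "i < m" for i
    using conn_first_edge [OF spans_conn [OF F(2) [OF that] assms(3,4)]] assms(5) by blast
  then obtain g where g: "\<And>i. i < m \<Longrightarrow> g i \<in> F i" "\<And>i. i < m \<Longrightarrow> z \<in> ends (g i)" by metis
  have "card {..<m} \<le> card {e \<in> ind A X. z \<in> ends e}"
  proof (rule card_inj_on_le)
    show "inj_on g {..<m}"
    proof (rule inj_onI, rule ccontr)
      fix i j assume "i \<in> {..<m}" "j \<in> {..<m}" "g i = g j" "i \<noteq> j"
      then show False using edge_disjointD [OF F(3), of i j "g i"] g(1) [of i] g(1) [of j] by simp
    qed
    show "g ` {..<m} \<subseteq> {e \<in> ind A X. z \<in> ends e}"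
    proof
      fix e assume "e \<in> g ` {..<m}"
      then obtain i where i: "i < m" "e = g i" by auto
      then show "e \<in> {e \<in> ind A X. z \<in> ends e}"
        using F(1) [OF i(1)] spans_ends [OF F(2) [OF i(1)] g(1) [OF i(1)]] g [OF i(1)]
        by (auto simp: ind_def)
    qed
    have "{e \<in> ind A X. z \<in> ends e} \<subseteq> E" using assms(2) by (auto simp: ind_def)
    then show "finite {e \<in> ind A X. z \<in> ends e}" by (rule finite_sub_E)
  qed
  then show ?thesis by simp
qed

subsection \<open>Exchanging an edge\<close>

lemma minimal_connection:
  assumes "(v, w) \<in> conn F" "finite F"
  obtains P where "P \<subseteq> F" "(v, w) \<in> conn P" "\<And>f. f \<in> P \<Longrightarrow> (v, w) \<notin> conn (P - {f})"
proof -
  let ?S = "{P. P \<subseteq> F \<and> (v, w) \<in> conn P}"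
  have "finite ?S" "F \<in> ?S" using assms by auto
  from finite_has_minimal2 [OF this]
  obtain P where P: "P \<in> ?S" and min: "\<forall>P' \<in> ?S. P' \<subseteq> P \<longrightarrow> P = P'" by blast
  have "(v, w) \<notin> conn (P - {f})" if "f \<in> P" for f
    using min P that by blast
  then show ?thesis using that P by blast
qed

text \<open>As \<open>f\<close> separates \<open>v\<close> from \<open>w\<close> in
  \<open>P\<close>, the set \<open>P\<close> leads from \<open>v\<close> to one end of
  \<open>f\<close> and from the other end to \<open>w\<close>; hence \<open>g\<close> closes a
  detour around \<open>f\<close>. The result is connected with an unchanged number of edges, so it
  is again a forest.\<close>

lemma spanning_forest_swap:
  assumes Z: "finite Z" "Z \<noteq> {}" and F: "F \<subseteq> E" "spans Z F" "forest F"
    and g: "g \<in> E" "ends g = {v, w}" "ends g \<subseteq> Z"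
    and P: "P \<subseteq> F" "(v, w) \<in> conn P" and f: "f \<in> P" "(v, w) \<notin> conn (P - {f})"
  shows "spans Z (insert g (F - {f}))" "forest (insert g (F - {f}))"
proof -
  let ?C = "insert g (F - {f})"
  have fF: "f \<in> F" using P f by blast
  obtain a b where ab: "ends f = {a, b}"
    by (rule ends_pair [of f]) (use fF F in auto)
  have sub: "conn (P - {f}) \<subseteq> conn ?C" using P by (intro conn_mono) auto
  have vw: "(v, w) \<in> conn ?C" using g(2) by (intro conn_edge [of g]) auto
  have "insert f (P - {f}) = P" using f(1) by blast
  then have "(v, a) \<in> conn (P - {f}) \<and> (b, w) \<in> conn (P - {f}) \<or>
      (v, b) \<in> conn (P - {f}) \<and> (a, w) \<in> conn (P - {f})"
    using conn_insert_cases [OF ab, of v w "P - {f}"] P(2) f(2) by simp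
  then have "(v, a) \<in> conn ?C \<and> (b, w) \<in> conn ?C \<or> (v, b) \<in> conn ?C \<and> (a, w) \<in> conn ?C"
    using sub by blast
  then have "(a, b) \<in> conn ?C" using vw by (meson conn_sym conn_trans)
  then have "conn (insert f ?C) = conn ?C" by (rule conn_insert_same [OF ab])
  moreover have "conn F \<subseteq> conn (insert f ?C)" by (intro conn_mono) auto
  ultimately have "conn F \<subseteq> conn ?C" by simp
  then show sp: "spans Z ?C"
    using F(2) g(3) unfolding spans_def by blast
  have "card ?C \<le> Suc (card (F - {f}))" by (rule card_insert_le_m1) simp_all
  also have "\<dots> = card F"
    using fF finite_sub_E [OF F(1)] by (simp add: card_Suc_Diff1 del: card_Diff_insert)
  finally have "card ?C \<le> card Z - 1" using forest_spans_card [OF Z F] by simp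
  then show "forest ?C" using F(1) g(1) by (intro spans_card_forest [OF Z _ sp]) auto
qed

definition swap :: "'v set \<Rightarrow> 'e set \<Rightarrow> (nat \<Rightarrow> 'e set) \<Rightarrow> (nat \<Rightarrow> 'e set) \<Rightarrow> bool" where
  "swap Z K F F' \<longleftrightarrow> packing Z K F' \<and>
     (\<exists>i < m. \<exists>g \<in> K - (\<Union>j<m. F j). \<exists>f \<in> F i. F' = F(i := insert g (F i - {f})))"

text \<open>If \<open>K\<close> is a minimally \<open>m\<close>-tree-connected set with one
  additional edge, as in \<open>exchange\<close>, this is the circuit of that edge in the
  \<open>m\<close>-fold union of the graphic matroid.\<close>

definition missed :: "'v set \<Rightarrow> 'e set \<Rightarrow> (nat \<Rightarrow> 'e set) \<Rightarrow> 'e set" where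
  "missed Z K F0 = {f \<in> K. \<exists>F. (swap Z K)\<^sup>*\<^sup>* F0 F \<and> f \<notin> (\<Union>j<m. F j)}"

lemma packing_swap_reachable:
  assumes "(swap Z K)\<^sup>*\<^sup>* F0 F" "packing Z K F0"
  shows "packing Z K F"
  using assms by (induction rule: rtranclp_induct) (auto simp: swap_def)

lemma packing_swap:
  assumes Z: "finite Z" "Z \<noteq> {}" and K: "K \<subseteq> E" and F: "packing Z K F" and i: "i < m"
    and g: "g \<in> K - (\<Union>j<m. F j)" "ends g = {v, w}" "ends g \<subseteq> Z"
    and P: "P \<subseteq> F i" "(v, w) \<in> conn P" and f: "f \<in> P" "(v, w) \<notin> conn (P - {f})"
  shows "packing Z K (F(i := insert g (F i - {f})))"
proof (rule packingI)
  have FE: "F i \<subseteq> E" using packingD(1) [OF F i] K by blast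
  have gE: "g \<in> E" using g(1) K by blast
  note new = spanning_forest_swap [OF Z FE packingD(2,3) [OF F i] gE g(2,3) P f]
  fix j assume j: "j < m"
  show "spans Z ((F(i := insert g (F i - {f}))) j)"
    using new(1) packingD(2) [OF F j] by simp
  show "forest ((F(i := insert g (F i - {f}))) j)"
    using new(2) packingD(3) [OF F j] by simp
  show "(F(i := insert g (F i - {f}))) j \<subseteq> K"
    using packingD(1) [OF F j] g(1) by auto
next
  show "edge_disjoint (F(i := insert g (F i - {f})))"
  proof (rule edge_disjointI)
    fix j k e
    assume *: "j < m" "k < m" "j \<noteq> k"
      "e \<in> (F(i := insert g (F i - {f}))) j" "e \<in> (F(i := insert g (F i - {f}))) k"
    then show False
      using edge_disjointD [OF packingD(4) [OF F] *(1-3), of e] g(1) by (auto split: if_splits)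
  qed
qed

text \<open>Let \<open>P\<close> be the path of \<open>F i\<close> between the ends of the uncovered
  edge \<open>g\<close>. Each edge of \<open>P\<close> can be swapped out in favour of
  \<open>g\<close>, so all of \<open>P\<close> is missed by packings that swaps can reach.\<close>

lemma conn_missed_edge:
  assumes Z: "finite Z" "Z \<noteq> {}" and K: "K \<subseteq> E" "\<forall>e \<in> K. ends e \<subseteq> Z"
    and F0: "packing Z K F0" and reach: "(swap Z K)\<^sup>*\<^sup>* F0 F"
    and g: "g \<in> K" "g \<notin> (\<Union>j<m. F j)" "ends g = {v, w}" and i: "i < m"
  shows "(v, w) \<in> conn (F i \<inter> missed Z K F0)"
proof -
  have F: "packing Z K F" by (rule packing_swap_reachable [OF reach F0])
  have FE: "F i \<subseteq> E" using packingD(1) [OF F i] K(1) by blast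
  have "(v, w) \<in> conn (F i)"
    using spans_conn [OF packingD(2) [OF F i], of v w] bspec [OF K(2) g(1)] g(3) by simp
  from this finite_sub_E [OF FE]
  obtain P where P: "P \<subseteq> F i" "(v, w) \<in> conn P" "\<And>f. f \<in> P \<Longrightarrow> (v, w) \<notin> conn (P - {f})"
    by (rule minimal_connection) blast
  have "f \<in> missed Z K F0" if f: "f \<in> P" for f
  proof -
    let ?F' = "F(i := insert g (F i - {f}))"
    have fF: "f \<in> F i" using P(1) f by blast
    have "packing Z K ?F'"
      using g bspec [OF K(2) g(1)] by (intro packing_swap [OF Z K(1) F i _ g(3) _ P(1,2) f P(3) [OF f]]) auto
    then have "swap Z K F ?F'"
      using i g fF unfolding swap_def by (intro conjI exI [of _ i] bexI [of _ g] bexI [of _ f]) auto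
    then have "(swap Z K)\<^sup>*\<^sup>* F0 ?F'" using reach by (rule rtranclp.rtrancl_into_rtrancl [rotated])
    moreover have "f \<notin> ?F' j" if j: "j < m" for j
      using edge_disjointD [OF packingD(4) [OF F] i j _ fF] fF g(2) i by (cases "j = i") auto
    moreover have "f \<in> K" using fF packingD(1) [OF F i] by blast
    ultimately show ?thesis by (auto simp: missed_def)
  qed
  then have "P \<subseteq> F i \<inter> missed Z K F0" using P(1) by blast
  then show ?thesis using P(2) conn_mono by blast
qed

text \<open>Swaps are undone one at a time: an edge that a swap adds to \<open>F i\<close> was missed just before,
  so its ends are already joined by missed edges of the old forest.\<close>

lemma conn_missed_reachable:
  assumes Z: "finite Z" "Z \<noteq> {}" and K: "K \<subseteq> E" "\<forall>e \<in> K. ends e \<subseteq> Z"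
    and F0: "packing Z K F0" and reach: "(swap Z K)\<^sup>*\<^sup>* F0 F" and i: "i < m"
  shows "conn (F i \<inter> missed Z K F0) \<subseteq> conn (F0 i \<inter> missed Z K F0)"
  using reach
proof (induction rule: rtranclp_induct)
  case base
  show ?case by simp
next
  case (step F F')
  let ?M = "missed Z K F0"
  obtain j g f where j: "j < m" "g \<in> K" "g \<notin> (\<Union>j<m. F j)" "f \<in> F j"
    "F' = F(j := insert g (F j - {f}))"
    using step.hyps(2) unfolding swap_def by blast
  have "conn (F' i \<inter> ?M) \<subseteq> conn (F i \<inter> ?M)"
  proof (rule conn_subsetI)
    fix e u v assume e: "e \<in> F' i \<inter> ?M" "ends e = {u, v}"
    show "(u, v) \<in> conn (F i \<inter> ?M)"
    proof (cases "e \<in> F i")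
      case True
      then show ?thesis using e by (intro conn_edge [of e]) auto
    next
      case False
      then have "e = g" using e(1) j(5) by (auto split: if_splits)
      then show ?thesis
        using conn_missed_edge [OF Z K F0 step.hyps(1) j(2,3) _ i] e(2) by blast
    qed
  qed
  then show ?case using step.IH by blast
qed

text \<open>Each tree of the starting packing alone connects what all missed edges together connect.
  Thus it stays connected when restricted to a component of the missed edges.\<close>

lemma conn_missed:
  assumes Z: "finite Z" "Z \<noteq> {}" and K: "K \<subseteq> E" "\<forall>e \<in> K. ends e \<subseteq> Z"
    and F0: "packing Z K F0" and i: "i < m"
  shows "conn (missed Z K F0) \<subseteq> conn (F0 i \<inter> missed Z K F0)"
proof (rule conn_subsetI)
  fix e u v assume e: "e \<in> missed Z K F0" "ends e = {u, v}"
  then obtain F where F: "(swap Z K)\<^sup>*\<^sup>* F0 F" "e \<in> K" "e \<notin> (\<Union>j<m. F j)"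
    unfolding missed_def by blast
  show "(u, v) \<in> conn (F0 i \<inter> missed Z K F0)"
    using conn_missed_edge [OF Z K F0 F e(2) i] conn_missed_reachable [OF Z K F0 F(1) i] by blast
qed

text \<open>\<open>U\<close> is the component of \<open>e\<close> in the graph of all edges missed by some packing that swaps can
  reach, as in Diestel's proof of the Nash-Williams--Tutte theorem.\<close>

lemma exchange:
  assumes A: "mtcon Z A" and e: "e \<in> E" "e \<notin> A" "ends e = {x, y}" "x \<in> Z" "y \<in> Z"
  obtains U where "x \<in> U" "y \<in> U" "U \<subseteq> Z" "tcon U A"
    "\<And>f. f \<in> ind A U \<Longrightarrow> mtcon Z (insert e (A - {f}))"
proof -
  have AE: "A \<subseteq> E" "\<And>f. f \<in> A \<Longrightarrow> ends f \<subseteq> Z" "Z \<subseteq> V" and Zne: "Z \<noteq> {}"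
    using A by (auto simp: mtcon_def tcon_def)
  have Zfin: "finite Z" using AE(3) by (rule finite_sub_V)
  obtain F0 where F0A: "packing Z A F0" "(\<Union>i<m. F0 i) = A"
    by (rule mtcon_packing [OF A])
  let ?K = "insert e A"
  have K: "?K \<subseteq> E" "\<forall>f \<in> ?K. ends f \<subseteq> Z" using AE e by auto
  have F0: "packing Z ?K F0"
    using packingD [OF F0A(1)] by (intro packingI) blast+
  let ?M = "missed Z ?K F0"
  note cm = conn_missed [OF Zfin Zne K F0]
  have MK: "?M \<subseteq> ?K" by (auto simp: missed_def)
  \<comment> \<open>The starting packing lies in \<open>A\<close>, so it misses \<open>e\<close>
    without any swap.\<close>
  have "e \<in> ?M" using e(2) F0A(2) unfolding missed_def by blast
  define U where "U = {v. (x, v) \<in> conn ?M}"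
  have xU: "x \<in> U" by (simp add: U_def)
  have yU: "y \<in> U" using \<open>e \<in> ?M\<close> e(3) conn_edge by (auto simp: U_def)
  have "v \<in> Z" if "(x, v) \<in> conn ?M" for v
    using that e(4)
  proof (rule conn_closed)
    fix f a b assume "f \<in> ?M" "ends f = {a, b}"
    then show "b \<in> Z" using bspec [OF K(2), of f] subsetD [OF MK, of f] by simp
  qed
  then have UZ: "U \<subseteq> Z" by (auto simp: U_def)
  have closed: "ends f \<subseteq> U" if "f \<in> ?M" "a \<in> ends f" "a \<in> U" for f a
  proof -
    have "f \<in> E" using that(1) MK K(1) by blast
    then obtain c d where cd: "ends f = {c, d}" by (rule ends_pair) blast
    then have *: "(c, d) \<in> conn ?M" "(d, c) \<in> conn ?M"
      using conn_edge [OF that(1), of c d] conn_edge [OF that(1), of d c] by (auto simp: insert_commute)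
    have "(x, a) \<in> conn ?M" "a = c \<or> a = d" using that cd by (auto simp: U_def)
    then show ?thesis using * cd conn_trans [of x a ?M] by (auto simp: U_def)
  qed
  \<comment> \<open>The witnesses are the starting trees restricted to missed edges in
    \<open>U\<close>. A connection by missed edges that starts in \<open>U\<close> never leaves
    \<open>U\<close>, by \<open>closed\<close>.\<close>
  have tU: "tcon U A"
  proof (rule tconI [of _ "\<lambda>i. ind (F0 i \<inter> ?M) U"])
    fix i assume i: "i < m"
    show "ind (F0 i \<inter> ?M) U \<subseteq> A" using F0A(2) i by (auto simp: ind_def)
    show "spans U (ind (F0 i \<inter> ?M) U)"
      unfolding spans_def
    proof (intro conjI ballI)
      fix u v assume u: "u \<in> U" and "v \<in> U"
      then have "(u, v) \<in> conn ?M"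
        using conn_trans [OF conn_sym [of x u ?M], of v] by (simp add: U_def)
      then have "(u, v) \<in> conn (F0 i \<inter> ?M)" using cm [OF i] by blast
      then have "v \<in> {v \<in> U. (u, v) \<in> conn (ind (F0 i \<inter> ?M) U)}"
      proof (rule conn_closed)
        show "u \<in> {v \<in> U. (u, v) \<in> conn (ind (F0 i \<inter> ?M) U)}" using u by simp
      next
        fix f a b assume f: "f \<in> F0 i \<inter> ?M" "ends f = {a, b}"
          and a: "a \<in> {v \<in> U. (u, v) \<in> conn (ind (F0 i \<inter> ?M) U)}"
        then have fU: "ends f \<subseteq> U" using closed [of f a] by auto
        then have "(a, b) \<in> conn (ind (F0 i \<inter> ?M) U)"
          using f by (intro conn_edge [of f]) (auto simp: ind_def)
        then show "b \<in> {v \<in> U. (u, v) \<in> conn (ind (F0 i \<inter> ?M) U)}"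
          using a fU f(2) conn_trans by fastforce
      qed
      then show "(u, v) \<in> conn (ind (F0 i \<inter> ?M) U)" by simp
    qed (simp add: ind_def)
  next
    show "edge_disjoint (\<lambda>i. ind (F0 i \<inter> ?M) U)"
    proof (rule edge_disjointI)
      fix i j f assume "i < m" "j < m" "i \<noteq> j" "f \<in> ind (F0 i \<inter> ?M) U" "f \<in> ind (F0 j \<inter> ?M) U"
      then show False using edge_disjointD [OF packingD(4) [OF F0], of i j f] by (simp add: ind_def)
    qed
  qed (use xU UZ AE in auto)
  have "mtcon Z (insert e (A - {f}))" if f: "f \<in> ind A U" for f
  proof -
    have fA: "f \<in> A" "ends f \<subseteq> U" using f by (auto simp: ind_def)
    then obtain i where i: "i < m" "f \<in> F0 i" using F0A(2) by blast
    obtain a b where ab: "ends f = {a, b}"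
      by (rule ends_pair [of f]) (use fA AE in auto)
    have "(a, b) \<in> conn ?M"
      using fA(2) ab conn_trans [OF conn_sym [of x a ?M], of b] by (simp add: U_def)
    then have abM: "(a, b) \<in> conn (F0 i \<inter> ?M)" using cm [OF i(1)] by blast
    \<comment> \<open>The missed edges of \<open>F0 i\<close> join the ends of \<open>f\<close>. If
      \<open>f\<close> were not among them, they would join its ends without \<open>f\<close>,
      whereas \<open>f\<close> is a bridge of the forest \<open>F0 i\<close>.\<close>
    have "f \<in> ?M"
    proof (rule ccontr)
      assume "f \<notin> ?M"
      then have "(a, b) \<in> conn (F0 i - {f})"
        using abM conn_mono [of "F0 i \<inter> ?M" "F0 i - {f}"] by blast
      then show False using packingD(3) [OF F0 i(1)] i(2) ab by (auto simp: forest_def)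
    qed
    then obtain F where F: "(swap Z ?K)\<^sup>*\<^sup>* F0 F" "f \<notin> (\<Union>j<m. F j)"
      unfolding missed_def by blast
    have pF: "packing Z ?K F" by (rule packing_swap_reachable [OF F(1) F0])
    have "tcon Z (insert e (A - {f}))"
    proof (rule tconI [of _ F])
      fix i assume "i < m"
      then show "F i \<subseteq> insert e (A - {f})" "spans Z (F i)"
        using packingD(1,2) [OF pF] F(2) by blast+
    qed (use Zne AE packingD(4) [OF pF] in auto)
    moreover have "card (insert e (A - {f})) = card A"
      using e(2) fA(1) finite_sub_E [OF AE(1)] by (simp add: card_Suc_Diff1 del: card_Diff_insert)
    ultimately show ?thesis using A K by (auto simp: mtcon_def)
  qed
  then show ?thesis using that xU yU UZ tU by blast
qed

text \<open>Exchange an edge \<open>f\<close> at \<open>z\<close> for \<open>e\<close>. By the edge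
  count \<open>U\<close> is still tree-connected, so \<open>z\<close> keeps degree at least
  \<open>m\<close> inside \<open>U\<close>; it has lost \<open>f\<close> and gained nothing, because
  \<open>e\<close> avoids \<open>z\<close>.\<close>

lemma exchange_degree:
  assumes A: "mtcon Z A" and U: "U \<subseteq> Z" "tcon U A"
    and e: "e \<in> E" "e \<notin> A" "ends e = {x, y}" "x \<in> U" "y \<in> U"
    and exch: "\<And>f. f \<in> ind A U \<Longrightarrow> mtcon Z (insert e (A - {f}))"
    and z: "z \<in> U" "z \<noteq> x" "z \<noteq> y"
  shows "m < card {f \<in> ind A U. z \<in> ends f}"
proof -
  have AE: "A \<subseteq> E" using A by (simp add: mtcon_def)
  have indE: "ind A U \<subseteq> E" using AE ind_subset by blast
  have "m \<le> card {f \<in> ind A U. z \<in> ends f}"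
    using tcon_degree_ge [OF U(2) AE z(1) e(4)] z(2) by simp
  then have "{f \<in> ind A U. z \<in> ends f} \<noteq> {}" using m_pos by force
  then obtain f where f: "f \<in> ind A U" "z \<in> ends f" by blast
  let ?B = "insert e (A - {f})"
  have B: "mtcon Z ?B" by (rule exch [OF f(1)])
  have indB: "ind ?B U = insert e (ind A U - {f})" using e by (auto simp: ind_def)
  have "card (ind ?B U) = card (ind A U)"
    unfolding indB using e(2) f(1) finite_sub_E [OF indE] ind_subset [of A U]
    by (subst card_insert_disjoint) (auto simp: card_Suc_Diff1 simp del: card_Diff_insert)
  also have "\<dots> = m * (card U - 1)"
    using mtcon_ind [OF A U(2,1)] by (simp add: mtcon_def)
  finally have "tcon U ?B" using mtcon_card_ind(2) [OF B U(1)] tcon_V(1) [OF U(2)] by blast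
  then have "m \<le> card {g \<in> ind ?B U. z \<in> ends g}"
    using tcon_degree_ge [of U ?B z x] z e AE by auto
  also have "{g \<in> ind ?B U. z \<in> ends g} = {g \<in> ind A U. z \<in> ends g} - {f}"
    using z e(3) indB by auto
  also have "card \<dots> < card {g \<in> ind A U. z \<in> ends g}"
    using f finite_sub_E [OF indE] by (intro card_Diff1_less) auto
  finally show ?thesis .
qed

subsection \<open>Growing the vertex set\<close>

definition deg :: "'e set \<Rightarrow> 'v \<Rightarrow> nat" where
  "deg A v = card {e \<in> A. v \<in> ends e}"

definition component :: "'e set \<Rightarrow> 'v set \<Rightarrow> 'v \<Rightarrow> 'v set" where
  "component A W v = \<Union> {X. X \<subseteq> W \<and> v \<in> X \<and> tcon X A}"

lemma component_upper: "X \<subseteq> W \<Longrightarrow> v \<in> X \<Longrightarrow> tcon X A \<Longrightarrow> X \<subseteq> component A W v"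
  by (auto simp: component_def)

lemma component_subset: "component A W v \<subseteq> W"
  by (auto simp: component_def)

text \<open>A maximal tree-connected set through \<open>v\<close> absorbs every other one by
  \<open>tcon_Un\<close>, so the union in \<open>component\<close> is attained by a single
  set.\<close>

lemma component_tcon:
  assumes "W \<subseteq> V" "v \<in> W"
  shows "tcon (component A W v) A" "v \<in> component A W v"
proof -
  let ?S = "{X. X \<subseteq> W \<and> v \<in> X \<and> tcon X A}"
  have "finite ?S" using finite_sub_V [OF assms(1)] by simp
  moreover have "{v} \<in> ?S" using assms tcon_singleton by auto
  ultimately obtain X where X: "X \<in> ?S" and max: "\<forall>Y \<in> ?S. X \<subseteq> Y \<longrightarrow> X = Y"
    using finite_has_maximal [of ?S] by blast
  have "Y \<subseteq> X" if "Y \<in> ?S" for Y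
  proof -
    have "tcon (X \<union> Y) A" using X that by (intro tcon_Un) auto
    then have "X \<union> Y \<in> ?S" using X that by auto
    then have "X = X \<union> Y" using max by blast
    then show ?thesis by blast
  qed
  then have "component A W v = X" using X unfolding component_def by blast
  then show "tcon (component A W v) A" "v \<in> component A W v" using X by auto
qed

lemma component_eq:
  assumes "W \<subseteq> V" "v \<in> W" "w \<in> component A W v"
  shows "component A W w = component A W v"
proof -
  have w: "w \<in> W" using assms(3) component_subset by blast
  have "component A W v \<subseteq> component A W w"
    by (intro component_upper component_subset assms(3) component_tcon(1) [OF assms(1,2)])
  moreover from this have "v \<in> component A W w" using component_tcon [OF assms(1,2)] by blast
  then have "component A W w \<subseteq> component A W v"
    by (intro component_upper component_subset component_tcon(1) [OF assms(1) w])
  ultimately show ?thesis by blast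
qed

lemma component_disjoint:
  assumes "W \<subseteq> V" "v \<in> W" "w \<in> W" "component A W v \<noteq> component A W w"
  shows "component A W v \<inter> component A W w = {}"
  using component_eq [OF assms(1,2)] component_eq [OF assms(1,3)] assms(4) by blast

text \<open>Contrapositive of the statement that all edges of \<open>E\<close> between different
  components belong to \<open>A\<close>. This is all that the equality of the two values of
  \<open>Omega\<close> requires of \<open>S\<close>.\<close>

definition saturated :: "'e set \<Rightarrow> 'v set \<Rightarrow> bool" where
  "saturated A W \<longleftrightarrow> (\<forall>e \<in> E - A. \<forall>x y. ends e = {x, y} \<longrightarrow> x \<in> W \<longrightarrow> y \<in> W \<longrightarrow>
     component A W x = component A W y)"

lemma saturatedD:
  "saturated A W \<Longrightarrow> e \<in> E \<Longrightarrow> e \<notin> A \<Longrightarrow> ends e = {x, y} \<Longrightarrow> x \<in> W \<Longrightarrow> y \<in> W \<Longrightarrow>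
    component A W x = component A W y"
  unfolding saturated_def by blast

section \<open>Adding an edge while two components are re-chosen\<close>

definition replaced :: "'e set \<Rightarrow> 'v set \<Rightarrow> 'e set \<Rightarrow> 'e set" where
  "replaced A X B = A - ind A X \<union> B"

lemma deg_le:
  assumes "{e \<in> A. v \<in> ends e} \<subseteq> {e \<in> B. v \<in> ends e}" "B \<subseteq> E"
  shows "deg A v \<le> deg B v"
  unfolding deg_def using assms by (intro card_mono finite_sub_E) auto

text \<open>Three changes are made inside \<open>Z\<close>: \<open>e\<close> is exchanged for an
  edge \<open>f\<close> at some \<open>z\<close> in \<open>S\<close>, and the edges inside
  \<open>X\<close> and inside \<open>Y\<close> become \<open>BX\<close> and \<open>BY\<close>. They
  do not interfere, since \<open>X\<close> and \<open>Y\<close> are disjoint and neither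
  \<open>e\<close> nor \<open>f\<close> lies inside one of them. Hence degrees in \<open>X\<close>
  are at most those after re-choosing \<open>X\<close> alone, except for one more edge at
  \<open>x\<close>, and likewise for \<open>Y\<close>.\<close>

lemma double_replacement:
  assumes A: "mtcon V A" and N: "N \<subseteq> A" "\<And>v. v \<in> V \<Longrightarrow> deg N v \<le> m"
    and Z: "tcon Z A" and S: "S \<subseteq> V"
    and e: "e \<in> E" "e \<notin> A" "ends e = {x, y}" "x \<in> V - S" "y \<in> V - S"
    and X: "X = component A (V - S) x" "X \<subseteq> Z" and Y: "Y = component A (V - S) y" "Y \<subseteq> Z"
    and XY: "X \<noteq> Y"
    and BX: "mtcon X BX" "ind N X \<subseteq> BX"
    and BY: "mtcon Y BY" "ind N Y \<subseteq> BY"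
  obtains z B where "z \<in> Z" "z \<in> S" "mtcon Z B" "ind N Z \<subseteq> B"
    "\<And>w. w \<in> X \<Longrightarrow> deg (replaced A Z B) w \<le> deg (replaced A X BX) w + of_bool (w = x)"
    "\<And>w. w \<in> Y \<Longrightarrow> deg (replaced A Z B) w \<le> deg (replaced A Y BY) w + of_bool (w = y)"
    "\<And>w. w \<notin> X \<union> Y \<Longrightarrow> deg (replaced A Z B) w \<le> deg A w"
    "deg (replaced A Z B) z < deg A z"
proof -
  have WV: "V - S \<subseteq> V" by blast
  have xX: "x \<in> X" and tX: "tcon X A" and XS: "X \<subseteq> V - S"
    unfolding X(1) using component_tcon [OF WV e(4)] component_subset by auto
  have yY: "y \<in> Y" and tY: "tcon Y A" and YS: "Y \<subseteq> V - S"
    unfolding Y(1) using component_tcon [OF WV e(5)] component_subset by auto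
  have dXY: "X \<inter> Y = {}"
    using component_disjoint [OF WV e(4,5)] XY X Y by blast
  have AE: "A \<subseteq> E" using A by (simp add: mtcon_def)
  have BE: "BX \<subseteq> E" "BY \<subseteq> E" using BX BY by (auto simp: mtcon_def)
  have BXe: "\<forall>g \<in> BX. ends g \<subseteq> X" and BYe: "\<forall>g \<in> BY. ends g \<subseteq> Y"
    using BX BY by (auto simp: mtcon_def)
  have AZ: "mtcon Z (ind A Z)" using mtcon_ind [OF A Z] tcon_V(2) [OF Z] by blast
  have eZ: "e \<notin> ind A Z" "x \<in> Z" "y \<in> Z" using e xX yY X Y by (auto simp: ind_def)
  obtain U where U: "x \<in> U" "y \<in> U" "U \<subseteq> Z" "tcon U (ind A Z)"
    and exch: "\<And>f. f \<in> ind (ind A Z) U \<Longrightarrow> mtcon Z (insert e (ind A Z - {f}))"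
    by (rule exchange [OF AZ e(1) eZ(1) e(3) eZ(2,3)]) blast
  \<comment> \<open>Otherwise \<open>U\<close> would be a tree-connected set avoiding
    \<open>S\<close> and containing \<open>x\<close> and \<open>y\<close>, hence part of both
    disjoint components.\<close>
  have "\<exists>z. z \<in> U \<inter> S"
  proof (rule ccontr)
    assume "\<nexists>z. z \<in> U \<inter> S"
    then have "U \<subseteq> V - S" using U(3) tcon_V(2) [OF Z] by blast
    moreover have "tcon U A" using tcon_mono [OF U(4)] ind_subset by blast
    ultimately have "U \<subseteq> X" "U \<subseteq> Y"
      unfolding X(1) Y(1) by (auto intro: subsetD [OF component_upper] U(1,2))
    then show False using U(1) dXY by blast
  qed
  then obtain z where z: "z \<in> U" "z \<in> S" by blast
  have zxy: "z \<noteq> x" "z \<noteq> y" "z \<notin> X" "z \<notin> Y" using z e XS YS by auto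
  have zV: "z \<in> V" using z S by blast
  have "m < card {f \<in> ind (ind A Z) U. z \<in> ends f}"
    by (rule exchange_degree [OF AZ U(3,4) e(1) eZ(1) e(3) U(1,2) exch z(1) zxy(1,2)])
  then have "card {f \<in> N. z \<in> ends f} < card {f \<in> ind (ind A Z) U. z \<in> ends f}"
    using N(2) [OF zV] by (simp add: deg_def)
  moreover have "finite {f \<in> N. z \<in> ends f}"
    using N(1) AE by (intro finite_sub_E) auto
  \<comment> \<open>At \<open>z\<close> there are more than \<open>m\<close> exchangeable edges but
    at most \<open>m\<close> edges of \<open>N\<close>, so one of the former can be given up without
    damage to \<open>N\<close>.\<close>
  ultimately have "\<not> {f \<in> ind (ind A Z) U. z \<in> ends f} \<subseteq> {f \<in> N. z \<in> ends f}"
    using card_mono leD by blast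
  then obtain f where f: "f \<in> ind (ind A Z) U" "z \<in> ends f" "f \<notin> N" by blast
  have fA: "f \<in> A" "ends f \<subseteq> Z" "f \<in> E" using f(1) AE by (auto simp: ind_def)
  have fXY: "\<not> ends f \<subseteq> X" "\<not> ends f \<subseteq> Y" using f(2) zxy by auto
  have eXY: "\<not> ends e \<subseteq> X" "\<not> ends e \<subseteq> Y" using e(3) xX yY dXY by auto
  have meet: "ends g \<noteq> {}" if "g \<in> E" for g using card_ends [OF that] by auto
  have not_both: "\<not> ends g \<subseteq> Y" if "g \<in> E" "ends g \<subseteq> X" for g
    using meet [OF that(1)] that(2) dXY by blast
  define B0 where "B0 = insert e (ind A Z - {f})"
  have B0: "mtcon Z B0" unfolding B0_def by (rule exch [OF f(1)])
  have indX: "ind B0 X = ind A X" using fXY eXY X(2) by (auto simp: B0_def ind_def)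
  have "tcon X B0"
    using tcon_ind [OF tX] indX tcon_mono ind_subset by metis
  then have "mtcon Z (B0 - ind A X \<union> BX)"
    using mtcon_replace [OF B0 BX(1) X(2)] indX by simp
  moreover define B1 where "B1 = B0 - ind A X \<union> BX"
  ultimately have mB1: "mtcon Z B1" by simp
  have indY: "ind B1 Y = ind A Y"
  proof -
    have "ind BX Y = {}" using not_both BXe BE by (auto simp: ind_def)
    moreover have "ind B0 Y = ind A Y" using fXY eXY Y(2) by (auto simp: B0_def ind_def)
    moreover have "ind A X \<inter> ind A Y = {}" using not_both AE by (auto simp: ind_def)
    moreover have "ind B1 Y = (ind B0 Y - ind A X) \<union> ind BX Y" by (auto simp: B1_def ind_def)
    ultimately show ?thesis by blast
  qed
  have "tcon Y B1"
    using tcon_ind [OF tY] indY tcon_mono ind_subset by metis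
  then have "mtcon Z (B1 - ind A Y \<union> BY)"
    using mtcon_replace [OF mB1 BY(1) Y(2)] unfolding indY by blast
  moreover define B where "B = B1 - ind A Y \<union> BY"
  ultimately have mB: "mtcon Z B" by simp
  let ?H = "replaced A Z B"
  have H_elem: "g = e \<or> g \<in> BX \<or> g \<in> BY \<or>
      g \<in> A \<and> \<not> ends g \<subseteq> X \<and> \<not> ends g \<subseteq> Y \<and> g \<noteq> f" if "g \<in> ?H" for g
    using that fA X(2) Y(2) unfolding replaced_def B_def B1_def B0_def ind_def by auto
  have AXE: "replaced A X BX \<subseteq> E" "replaced A Y BY \<subseteq> E" using AE BE by (auto simp: replaced_def)
  \<comment> \<open>The only edge at \<open>w\<close> that may be absent from the comparison set
    \<open>C\<close> is \<open>e\<close>, and \<open>e\<close> meets \<open>w\<close> only if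
    \<open>w = v\<close>.\<close>
  have insert_case: "deg ?H w \<le> deg C w + of_bool (w = v)"
    if "C \<subseteq> E" "w \<in> ends e \<Longrightarrow> w = v"
      "\<And>g. g \<in> ?H \<Longrightarrow> w \<in> ends g \<Longrightarrow> g = e \<or> g \<in> C" for C w v
  proof (cases "w = v")
    case True
    have "deg ?H w \<le> card (insert e {g \<in> C. w \<in> ends g})"
      unfolding deg_def using that(1,3) finite_sub_E [of C] by (intro card_mono) auto
    also have "\<dots> \<le> Suc (deg C w)"
      unfolding deg_def by (rule card_insert_le_m1) simp_all
    finally show ?thesis using True by simp
  next
    case False
    then show ?thesis using that deg_le [of ?H w C] by auto
  qed
  show ?thesis
  proof (rule that [of z B])
    show "z \<in> Z" "z \<in> S" "mtcon Z B" using z U(3) mB by auto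
    show "ind N Z \<subseteq> B"
    proof
      fix g assume g: "g \<in> ind N Z"
      then have gA: "g \<in> A" "g \<in> E" "g \<noteq> f" using N(1) AE f(3) by (auto simp: ind_def)
      show "g \<in> B"
      proof (cases "ends g \<subseteq> X")
        case True
        then have "g \<in> BX" using g BX(2) by (auto simp: ind_def)
        then show ?thesis using not_both [OF gA(2) True] by (auto simp: B_def B1_def ind_def)
      next
        case False
        note nX = False
        show ?thesis
        proof (cases "ends g \<subseteq> Y")
          case True
          then have "g \<in> BY" using g BY(2) by (auto simp: ind_def)
          then show ?thesis by (simp add: B_def)
        next
          case False
          with nX g gA show ?thesis by (auto simp: B_def B1_def B0_def ind_def)
        qed
      qed
    qed
    show "deg ?H w \<le> deg (replaced A X BX) w + of_bool (w = x)" if w: "w \<in> X" for w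
    proof (rule insert_case [OF AXE(1)])
      show "w = x" if "w \<in> ends e" using that w e(3) yY dXY by auto
      show "g = e \<or> g \<in> replaced A X BX" if "g \<in> ?H" "w \<in> ends g" for g
        using H_elem [OF that(1)] that(2) w BYe dXY by (auto simp: replaced_def ind_def)
    qed
    show "deg ?H w \<le> deg (replaced A Y BY) w + of_bool (w = y)" if w: "w \<in> Y" for w
    proof (rule insert_case [OF AXE(2)])
      show "w = y" if "w \<in> ends e" using that w e(3) xX dXY by auto
      show "g = e \<or> g \<in> replaced A Y BY" if "g \<in> ?H" "w \<in> ends g" for g
        using H_elem [OF that(1)] that(2) w BXe dXY by (auto simp: replaced_def ind_def)
    qed
    have outside: "{g \<in> ?H. w \<in> ends g} \<subseteq> {g \<in> A. w \<in> ends g} - {f}" if w: "w \<notin> X \<union> Y" for w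
    proof
      fix g assume "g \<in> {g \<in> ?H. w \<in> ends g}"
      then show "g \<in> {g \<in> A. w \<in> ends g} - {f}"
        using H_elem [of g] w BXe BYe e(3) xX yY by auto
    qed
    show "deg ?H w \<le> deg A w" if w: "w \<notin> X \<union> Y" for w
      using outside [OF w] by (intro deg_le AE) auto
    have fin: "finite {g \<in> A. z \<in> ends g}" using AE by (intro finite_sub_E) auto
    have "deg ?H z \<le> card ({g \<in> A. z \<in> ends g} - {f})"
      unfolding deg_def using outside [of z] zxy fin by (intro card_mono) auto
    also have "\<dots> < deg A z"
      unfolding deg_def using fin f(2) fA(1) by (intro card_Diff1_less) auto
    finally show "deg ?H z < deg A z" .
  qed
qed

section \<open>The stages of the growing vertex set\<close>

definition alternative :: "'e set \<Rightarrow> 'e set \<Rightarrow> ('v \<Rightarrow> int) \<Rightarrow> 'v set \<Rightarrow> 'e set \<Rightarrow> bool" where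
  "alternative A N h X B \<longleftrightarrow> mtcon X B \<and> ind N X \<subseteq> B \<and>
     (\<forall>w \<in> X. int (deg (replaced A X B) w) \<le> h w)"

definition grow :: "'e set \<Rightarrow> 'e set \<Rightarrow> ('v \<Rightarrow> int) \<Rightarrow> 'v set \<Rightarrow> 'v set" where
  "grow A N h S = S \<union> {v \<in> V - S. \<forall>B. alternative A N h (component A (V - S) v) B \<longrightarrow>
     h v \<le> int (deg (replaced A (component A (V - S) v) B) v)}"

primrec stage :: "'e set \<Rightarrow> 'e set \<Rightarrow> ('v \<Rightarrow> int) \<Rightarrow> nat \<Rightarrow> 'v set" where
  "stage A N h 0 = {v \<in> V. h v < int (deg A v)}"
| "stage A N h (Suc k) = grow A N h (stage A N h k)"

lemma stage_V: "stage A N h k \<subseteq> V"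
  by (induction k) (auto simp: grow_def)

lemma stage_Suc: "stage A N h k \<subseteq> stage A N h (Suc k)"
  by (auto simp: grow_def)

lemma stage_0: "stage A N h 0 \<subseteq> stage A N h k"
proof (induction k)
  case (Suc k)
  then show ?case using stage_Suc by (rule subset_trans)
qed simp

text \<open>The stages increase inside the finite set \<open>V\<close>; a stage of greatest size
  equals its successor.\<close>

lemma stage_stable: "\<exists>k. stage A N h (Suc k) = stage A N h k"
proof -
  have "\<exists>k. \<forall>j. card (stage A N h j) \<le> card (stage A N h k)"
    using ex_has_greatest_nat [of "\<lambda>_. True" 0 "\<lambda>k. card (stage A N h k)" "Suc (card V)"]
    by (simp add: card_mono [OF finite_V stage_V] less_Suc_eq_le)
  then obtain k where "\<And>j. card (stage A N h j) \<le> card (stage A N h k)" by blast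
  then have "stage A N h k = stage A N h (Suc k)"
    by (intro card_seteq stage_Suc finite_sub_V stage_V)
  then show ?thesis by metis
qed

lemma not_grow:
  assumes "v \<in> V - grow A N h S"
  obtains B where "v \<in> V - S" "alternative A N h (component A (V - S) v) B"
    "int (deg (replaced A (component A (V - S) v) B) v) < h v"
  using assms by (auto simp: grow_def not_le)

text \<open>Since \<open>x\<close> and \<open>y\<close> are not added, their components have
  alternatives with degree strictly below \<open>h\<close> at \<open>x\<close> and at
  \<open>y\<close>. This slack absorbs the additional edge in
  \<open>double_replacement\<close>.\<close>

lemma grow_improvement:
  assumes A: "mtcon V A" and N: "N \<subseteq> A" "\<And>v. v \<in> V \<Longrightarrow> deg N v \<le> m"
    and Z: "tcon Z A" and S: "S \<subseteq> V"
    and e: "e \<in> E" "e \<notin> A" "ends e = {x, y}"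
    and x: "x \<in> V - grow A N h S" "component A (V - S) x \<subseteq> Z"
    and y: "y \<in> V - grow A N h S" "component A (V - S) y \<subseteq> Z"
    and ne: "component A (V - S) x \<noteq> component A (V - S) y"
  obtains z B where "z \<in> Z" "z \<in> S" "mtcon Z B" "ind N Z \<subseteq> B"
    "\<And>w. int (deg (replaced A Z B) w) \<le> max (h w) (int (deg A w))"
    "deg (replaced A Z B) z < deg A z"
proof -
  let ?X = "component A (V - S) x" and ?Y = "component A (V - S) y"
  obtain BX where BX: "x \<in> V - S" "alternative A N h ?X BX"
    "int (deg (replaced A ?X BX) x) < h x"
    by (rule not_grow [OF x(1)]) blast
  obtain BY where BY: "y \<in> V - S" "alternative A N h ?Y BY"
    "int (deg (replaced A ?Y BY) y) < h y"
    by (rule not_grow [OF y(1)]) blast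
  have alt: "mtcon ?X BX" "ind N ?X \<subseteq> BX" "mtcon ?Y BY" "ind N ?Y \<subseteq> BY"
    using BX(2) BY(2) by (auto simp: alternative_def)
  have hX: "int (deg (replaced A ?X BX) w) \<le> h w" if "w \<in> ?X" for w
    using BX(2) that by (simp add: alternative_def)
  have hY: "int (deg (replaced A ?Y BY) w) \<le> h w" if "w \<in> ?Y" for w
    using BY(2) that by (simp add: alternative_def)
  obtain z B where zB: "z \<in> Z" "z \<in> S" "mtcon Z B" "ind N Z \<subseteq> B"
    and dX: "\<And>w. w \<in> ?X \<Longrightarrow> deg (replaced A Z B) w \<le> deg (replaced A ?X BX) w + of_bool (w = x)"
    and dY: "\<And>w. w \<in> ?Y \<Longrightarrow> deg (replaced A Z B) w \<le> deg (replaced A ?Y BY) w + of_bool (w = y)"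
    and dO: "\<And>w. w \<notin> ?X \<union> ?Y \<Longrightarrow> deg (replaced A Z B) w \<le> deg A w"
    and dz: "deg (replaced A Z B) z < deg A z"
    by (rule double_replacement [OF A N Z S e BX(1) BY(1) refl x(2) refl y(2) ne alt]) blast+
  have "int (deg (replaced A Z B) w) \<le> max (h w) (int (deg A w))" for w
  proof -
    consider "w \<in> ?X" | "w \<in> ?Y" | "w \<notin> ?X \<union> ?Y" by blast
    then show ?thesis
    proof cases
      case 1
      then show ?thesis using dX [OF 1] hX [OF 1] BX(3) by (cases "w = x") auto
    next
      case 2
      then show ?thesis using dY [OF 2] hY [OF 2] BY(3) by (cases "w = y") auto
    next
      case 3
      then show ?thesis using dO [OF 3] by simp
    qed
  qed
  then show ?thesis using that zB dz by blast
qed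

lemma same_component:
  assumes A: "mtcon V A" and N: "N \<subseteq> A" "\<And>v. v \<in> V \<Longrightarrow> deg N v \<le> m"
    and min: "\<And>B. mtcon V B \<Longrightarrow> N \<subseteq> B \<Longrightarrow>
      (\<Sum>v\<in>V. max 0 (int (deg A v) - h v)) \<le> (\<Sum>v\<in>V. max 0 (int (deg B v) - h v))"
    and e: "e \<in> E" "e \<notin> A" "ends e = {x, y}"
  shows "x \<in> V - stage A N h (Suc k) \<Longrightarrow> y \<in> V - stage A N h (Suc k) \<Longrightarrow>
    component A (V - stage A N h k) x = component A (V - stage A N h k) y"
proof (induction k)
  case 0
  let ?S = "stage A N h 0"
  have AV: "tcon V A" "\<forall>g \<in> A. ends g \<subseteq> V" using A by (auto simp: mtcon_def)
  have x: "x \<in> V - grow A N h ?S" and y: "y \<in> V - grow A N h ?S"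
    using 0 by simp_all
  show ?case
  proof (rule ccontr)
    assume ne: "component A (V - ?S) x \<noteq> component A (V - ?S) y"
    have sub: "component A (V - ?S) v \<subseteq> V" for v using component_subset by blast
    \<comment> \<open>With \<open>Z = V\<close> the improvement is a competitor for the whole
      factor: no excess rises, and the positive excess at \<open>z\<close> falls.\<close>
    obtain z B where z: "z \<in> V" "z \<in> ?S" and B: "mtcon V B" "ind N V \<subseteq> B"
      and le: "\<And>w. int (deg (replaced A V B) w) \<le> max (h w) (int (deg A w))"
      and less: "deg (replaced A V B) z < deg A z"
      by (rule grow_improvement [OF A N AV(1) stage_V e x sub y sub ne]) blast+
    have [simp]: "replaced A V B = B" using AV(2) by (auto simp: replaced_def ind_def)
    have "N \<subseteq> B" using B(2) N(1) AV(2) by (auto simp: ind_def)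
    have "(\<Sum>v\<in>V. max 0 (int (deg B v) - h v)) < (\<Sum>v\<in>V. max 0 (int (deg A v) - h v))"
    proof (rule sum_strict_mono_ex1 [OF finite_V])
      show "\<forall>v \<in> V. max 0 (int (deg B v) - h v) \<le> max 0 (int (deg A v) - h v)"
      proof
        fix v
        show "max 0 (int (deg B v) - h v) \<le> max 0 (int (deg A v) - h v)"
          using le [of v] by simp
      qed
      have "max 0 (int (deg B z) - h z) < max 0 (int (deg A z) - h z)"
        using less z(2) by simp
      then show "\<exists>v \<in> V. max 0 (int (deg B v) - h v) < max 0 (int (deg A v) - h v)"
        using z(1) by blast
    qed
    then show False using min [OF B(1) \<open>N \<subseteq> B\<close>] by simp
  qed
next
  case (Suc k)
  let ?S = "stage A N h k" and ?S' = "stage A N h (Suc k)"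
  let ?Z = "component A (V - ?S) x"
  have WV: "V - ?S \<subseteq> V" and WV': "V - ?S' \<subseteq> V" by blast+
  have x': "x \<in> V - ?S'" and y': "y \<in> V - ?S'"
    using Suc.prems stage_Suc [of A N h "Suc k"] by blast+
  have xy: "x \<in> V - ?S" "y \<in> V - ?S" using x' y' stage_Suc by blast+
  have x: "x \<in> V - grow A N h ?S'" and y: "y \<in> V - grow A N h ?S'"
    using Suc.prems by simp_all
  \<comment> \<open>The induction hypothesis puts \<open>x\<close> and \<open>y\<close> into one
    component of the previous stage, which is the set \<open>Z\<close> in which the exchange takes
    place.\<close>
  have Zy: "?Z = component A (V - ?S) y" using Suc.IH [OF x' y'] .
  have sub: "component A (V - ?S') v \<subseteq> component A (V - ?S) v" if "v \<in> V - ?S'" for v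
  proof (rule component_upper [OF _ component_tcon(2,1) [OF WV' that]])
    show "component A (V - ?S') v \<subseteq> V - ?S"
      using component_subset [of A "V - ?S'" v] stage_Suc [of A N h k] by blast
  qed
  have tZ: "tcon ?Z A" using component_tcon(1) [OF WV xy(1)] .
  show ?case
  proof (rule ccontr)
    assume ne: "component A (V - ?S') x \<noteq> component A (V - ?S') y"
    obtain z B where z: "z \<in> ?Z" "z \<in> ?S'" and B: "mtcon ?Z B" "ind N ?Z \<subseteq> B"
      and le: "\<And>w. int (deg (replaced A ?Z B) w) \<le> max (h w) (int (deg A w))"
      and less: "deg (replaced A ?Z B) z < deg A z"
      by (rule grow_improvement [OF A N tZ stage_V e x sub [OF x'] y sub [OF y', folded Zy] ne]) blast+
    have small: "int (deg A w) \<le> h w" if "w \<in> ?Z" for w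
    proof -
      have "w \<in> V - ?S" using that component_subset by blast
      then have "w \<in> V" "w \<notin> stage A N h 0" using stage_0 by blast+
      then show ?thesis by simp
    qed
    \<comment> \<open>The vertex \<open>z\<close> lies in \<open>?Z\<close>, so it is new in stage
      \<open>Suc k\<close>: no alternative on its previous component brings it below
      \<open>h z\<close>. Yet \<open>B\<close> is such an alternative, and it lowers a degree that
      was at most \<open>h z\<close>.\<close>
    have alt: "alternative A N h ?Z B"
      unfolding alternative_def
    proof (intro conjI ballI B)
      fix w assume "w \<in> ?Z"
      then show "int (deg (replaced A ?Z B) w) \<le> h w" using le [of w] small [of w] by simp
    qed
    have "component A (V - ?S) z = ?Z" by (rule component_eq [OF WV xy(1) z(1)])
    moreover have "z \<notin> ?S" using z(1) component_subset by blast
    ultimately have "h z \<le> int (deg (replaced A ?Z B) z)"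
      using z(2) alt by (auto simp: grow_def)
    then show False using less small [OF z(1)] by simp
  qed
qed

lemma good_vertex_set:
  assumes A: "mtcon V A" and N: "N \<subseteq> A" "\<And>v. v \<in> V \<Longrightarrow> deg N v \<le> m"
    and min: "\<And>B. mtcon V B \<Longrightarrow> N \<subseteq> B \<Longrightarrow>
      (\<Sum>v\<in>V. max 0 (int (deg A v) - h v)) \<le> (\<Sum>v\<in>V. max 0 (int (deg B v) - h v))"
  obtains S where "S \<subseteq> V" "{v \<in> V. h v < int (deg A v)} \<subseteq> S"
    "\<forall>v \<in> S. h v \<le> int (deg A v)"
    "saturated A (V - S)"
proof -
  obtain k where k: "stage A N h (Suc k) = stage A N h k" using stage_stable by blast
  have deg_ge: "h v \<le> int (deg A v)" if "v \<in> stage A N h j" for v j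
    using that
  proof (induction j)
    case 0
    then show ?case by simp
  next
    case (Suc j)
    let ?S = "stage A N h j"
    show ?case
    proof (cases "v \<in> ?S")
      case True
      then show ?thesis by (rule Suc.IH)
    next
      case False
      let ?X = "component A (V - ?S) v"
      have v: "v \<in> V - ?S"
        "alternative A N h ?X B \<Longrightarrow> h v \<le> int (deg (replaced A ?X B) v)" for B
        using False Suc.prems by (auto simp: grow_def)
      have X: "?X \<subseteq> V - ?S" "tcon ?X A"
        using component_subset component_tcon(1) [OF _ v(1)] by blast+
      have rep: "replaced A ?X (ind A ?X) = A" by (auto simp: replaced_def ind_def)
      \<comment> \<open>The unchanged choice is itself an alternative, because all vertices with
        excess are already in stage 0. The rule for adding \<open>v\<close> thus bounds the degree
        of \<open>v\<close> in \<open>A\<close>.\<close>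
      have "alternative A N h ?X (ind A ?X)"
        unfolding alternative_def rep
      proof (intro conjI ballI)
        show "mtcon ?X (ind A ?X)" using mtcon_ind [OF A X(2)] X(1) by blast
        show "ind N ?X \<subseteq> ind A ?X" using N(1) by (auto simp: ind_def)
        fix w assume "w \<in> ?X"
        then have "w \<in> V" "w \<notin> stage A N h 0" using X(1) stage_0 by blast+
        then show "int (deg A w) \<le> h w" by simp
      qed
      then show ?thesis using v(2) [of "ind A ?X"] rep by simp
    qed
  qed
  show ?thesis
  proof (rule that [of "stage A N h k"])
    show "{v \<in> V. h v < int (deg A v)} \<subseteq> stage A N h k"
      using stage_0 [of A N h k] by simp
    show "saturated A (V - stage A N h k)"
      unfolding saturated_def
    proof (intro ballI allI impI)
      fix e x y
      assume "e \<in> E - A" "ends e = {x, y}" "x \<in> V - stage A N h k" "y \<in> V - stage A N h k"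
      then show "component A (V - stage A N h k) x = component A (V - stage A N h k) y"
        using same_component [OF A N min, of e x y k] k by simp
    qed
  qed (use stage_V deg_ge in auto)
qed

subsection \<open>Tree-connected components\<close>

definition components :: "'e set \<Rightarrow> 'v set \<Rightarrow> 'v set set" where
  "components A W = {X. X \<subseteq> W \<and> tcon X A \<and> (\<forall>Y. X \<subset> Y \<and> Y \<subseteq> W \<longrightarrow> \<not> tcon Y A)}"

lemma componentsD:
  assumes "X \<in> components A W"
  shows "X \<subseteq> W" "tcon X A" "tcon Y A \<Longrightarrow> X \<subseteq> Y \<Longrightarrow> Y \<subseteq> W \<Longrightarrow> Y = X"
  using assms unfolding components_def by auto

lemma componentsI:
  assumes "X \<subseteq> W" "tcon X A" "\<And>Y. tcon Y A \<Longrightarrow> X \<subseteq> Y \<Longrightarrow> Y \<subseteq> W \<Longrightarrow> Y \<subseteq> X"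
  shows "X \<in> components A W"
  using assms unfolding components_def by auto

lemma components_meet:
  assumes "X \<in> components A W" "Y \<in> components A W" "X \<inter> Y \<noteq> {}"
  shows "X = Y"
proof -
  have "tcon (X \<union> Y) A" "X \<union> Y \<subseteq> W"
    using tcon_Un [OF componentsD(2) [OF assms(1)] componentsD(2) [OF assms(2)] assms(3)]
      componentsD(1) [OF assms(1)] componentsD(1) [OF assms(2)] by auto
  then have "X \<union> Y = X" "X \<union> Y = Y"
    using componentsD(3) [OF assms(1), of "X \<union> Y"] componentsD(3) [OF assms(2), of "X \<union> Y"]
    by auto
  then show ?thesis by blast
qed

lemma component_in_components:
  assumes "W \<subseteq> V" "v \<in> W"
  shows "component A W v \<in> components A W"
proof -
  note tc = component_tcon [OF assms]
  show ?thesis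
  proof (rule componentsI [OF component_subset tc(1)])
    fix Y assume "tcon Y A" "component A W v \<subseteq> Y" "Y \<subseteq> W"
    then show "Y \<subseteq> component A W v" using tc(2) by (intro component_upper) auto
  qed
qed

text \<open>Exchanging the edges inside a component of \<open>A\<close> for edges of \<open>A\<close> removes
  all edges outside \<open>A\<close>, one at a time.\<close>

lemma tcon_absorb:
  assumes W: "W \<subseteq> V" and AE: "A \<subseteq> E"
    and same: "saturated A W"
    and Y: "tcon Y C" "C \<subseteq> E" "Y \<subseteq> W"
  shows "\<exists>Y'. Y \<subseteq> Y' \<and> Y' \<subseteq> W \<and> tcon Y' A"
  using Y
proof (induction "card (C - A)" arbitrary: C Y rule: less_induct)
  case less
  show ?case
  proof (cases "ind C Y \<subseteq> A")
    case True
    then have "tcon Y A" using tcon_mono [OF tcon_ind [OF less.prems(1)]] by blast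
    then show ?thesis using less.prems(3) by blast
  next
    case False
    then obtain e where e: "e \<in> C" "ends e \<subseteq> Y" "e \<notin> A" by (auto simp: ind_def)
    have eE: "e \<in> E" using e(1) less.prems(2) by blast
    obtain x y where xy: "ends e = {x, y}" by (rule ends_pair [OF eE]) blast
    have xyW: "x \<in> W" "y \<in> W" using xy e(2) less.prems(3) by auto
    let ?X = "component A W x"
    have "x \<in> ?X" "y \<in> ?X" and tX: "tcon ?X A"
      using component_tcon [OF W xyW(1)] component_tcon [OF W xyW(2)]
        saturatedD [OF same eE e(3) xy xyW] by auto
    then have eX: "ends e \<subseteq> ?X" using xy by simp
    \<comment> \<open>All edges inside \<open>?X\<close> are cut back to those of \<open>A\<close>.
      This removes \<open>e\<close> and brings in no new edge outside \<open>A\<close>, so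
      \<open>card (K - A)\<close> decreases.\<close>
    define K where "K = C \<union> A - ind (C \<union> A) ?X \<union> A"
    have "tcon (Y \<union> ?X) (C \<union> A)"
    proof (rule tcon_Un)
      show "Y \<inter> ?X \<noteq> {}" using \<open>x \<in> ?X\<close> xy e(2) by auto
    qed (use tcon_mono less.prems(1) tX in blast)+
    then have tK: "tcon (Y \<union> ?X) K" unfolding K_def using tX by (rule tcon_replace) blast
    have "K - A \<subset> C - A" using e eX by (auto simp: K_def ind_def)
    then have less_card: "card (K - A) < card (C - A)"
      using finite_sub_E [OF less.prems(2)] by (intro psubset_card_mono) auto
    moreover have "K \<subseteq> E" using less.prems(2) AE by (auto simp: K_def)
    moreover have "Y \<union> ?X \<subseteq> W" using less.prems(3) component_subset by blast
    ultimately obtain Y' where "Y \<union> ?X \<subseteq> Y'" "Y' \<subseteq> W" "tcon Y' A"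
      using less.hyps [of K "Y \<union> ?X"] tK by blast
    then show ?thesis by blast
  qed
qed

text \<open>Every tree-connected set of \<open>E\<close> in \<open>W\<close> lies in one of
  \<open>A\<close> by \<open>tcon_absorb\<close>, so the maximal ones coincide.\<close>

lemma components_same:
  assumes W: "W \<subseteq> V" and AE: "A \<subseteq> E"
    and same: "saturated A W"
  shows "components E W = components A W"
proof -
  note absorb = tcon_absorb [OF W AE same _ order_refl]
  show ?thesis
  proof (intro equalityI subsetI)
    fix X assume X: "X \<in> components E W"
    obtain Y where Y: "X \<subseteq> Y" "Y \<subseteq> W" "tcon Y A"
      using absorb [OF componentsD(2,1) [OF X]] by blast
    then have "Y = X" using componentsD(3) [OF X tcon_mono [OF Y(3) AE]] by blast
    then have XA: "tcon X A" using Y by simp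
    show "X \<in> components A W"
    proof (rule componentsI [OF componentsD(1) [OF X] XA])
      fix Y assume "tcon Y A" "X \<subseteq> Y" "Y \<subseteq> W"
      then show "Y \<subseteq> X" using componentsD(3) [OF X tcon_mono [OF _ AE]] by blast
    qed
  next
    fix X assume X: "X \<in> components A W"
    show "X \<in> components E W"
    proof (rule componentsI [OF componentsD(1) [OF X] tcon_mono [OF componentsD(2) [OF X] AE]])
      fix Y assume Y: "tcon Y E" "X \<subseteq> Y" "Y \<subseteq> W"
      obtain Y' where "Y \<subseteq> Y'" "Y' \<subseteq> W" "tcon Y' A"
        using absorb [OF Y(1,3)] by blast
      then show "Y \<subseteq> X" using componentsD(3) [OF X, of Y'] Y(2) by blast
    qed
  qed
qed

text \<open>By saturation, an edge outside \<open>A\<close> has both ends in one component and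
  cannot cross between two.\<close>

lemma crossing_same:
  assumes W: "W \<subseteq> V" and AE: "A \<subseteq> E"
    and same: "saturated A W"
    and e: "e \<in> E" "ends e \<subseteq> W"
    and X: "X \<in> components A W" "ends e \<inter> X \<noteq> {}"
    and Y: "Y \<in> components A W" "ends e \<inter> Y \<noteq> {}"
    and XY: "X \<noteq> Y"
  shows "e \<in> A"
proof (rule ccontr)
  assume eA: "e \<notin> A"
  obtain x y where xy: "ends e = {x, y}" by (rule ends_pair [OF e(1)]) blast
  have xyW: "x \<in> W" "y \<in> W" using xy e(2) by auto
  let ?C = "component A W x"
  have "x \<in> ?C" "y \<in> ?C"
    using component_tcon(2) [OF W xyW(1)] component_tcon(2) [OF W xyW(2)]
      saturatedD [OF same e(1) eA xy xyW] by auto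
  then have "X \<inter> ?C \<noteq> {}" "Y \<inter> ?C \<noteq> {}" using X(2) Y(2) xy by auto
  then have "X = ?C" "Y = ?C"
    using components_meet [OF X(1) component_in_components [OF W xyW(1)]]
      components_meet [OF Y(1) component_in_components [OF W xyW(1)]] by blast+
  then show False using XY by simp
qed

subsection \<open>Translation to multigraphs\<close>

definition represents :: "('v, 'e) mgraph \<Rightarrow> 'v set \<Rightarrow> 'e set \<Rightarrow> bool" where
  "represents T X A \<longleftrightarrow> mverts T = X \<and> medges T = A \<and> X \<subseteq> V \<and> A \<subseteq> E \<and>
     (\<forall>e \<in> A. mends T e = ends e \<and> ends e \<subseteq> X)"

lemma madjacent_edge_factor:
  assumes "represents T X A" "F \<subseteq> A"
  shows "(madjacent (edge_factor T F))\<^sup>* = conn F"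
proof -
  have "mends T e = ends e" if "e \<in> F" for e
    using assms that by (auto simp: represents_def)
  then have "madjacent (edge_factor T F) = {(u, v). \<exists>e \<in> F. ends e = {u, v}}"
    by (auto simp: madjacent_def edge_factor_def)
  then show ?thesis by (simp add: conn_def)
qed

lemma spans_iff_mconnected:
  assumes "represents T X A" "F \<subseteq> A"
  shows "mconnected (edge_factor T F) \<longleftrightarrow> X \<noteq> {} \<and> spans X F"
proof -
  have "mverts (edge_factor T F) = X" "\<forall>e \<in> F. ends e \<subseteq> X"
    using assms by (auto simp: represents_def edge_factor_def)
  then show ?thesis
    unfolding mconnected_def madjacent_edge_factor [OF assms] by (simp add: spans_def)
qed

text \<open>All edges of a cycle but the closing one form a path between the ends of the closing
  edge, which is therefore no bridge.\<close>

lemma forest_no_mcycle: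
  assumes T: "represents T X A" "F \<subseteq> A" and F: "forest F"
  shows "\<not> mcycle (edge_factor T F) us es"
proof
  assume cyc: "mcycle (edge_factor T F) us es"
  define n where "n = length us"
  have n: "n \<ge> 2" "length es = n" "distinct es" and esF: "set es \<subseteq> F"
    and en: "\<And>i. i < n \<Longrightarrow> mends T (es ! i) = {us ! i, us ! (Suc i mod n)}"
    using cyc by (auto simp: mcycle_def n_def edge_factor_def)
  have in_F: "es ! i \<in> F" if "i < n" for i using esF n(2) that by auto
  have en': "ends (es ! i) = {us ! i, us ! (Suc i mod n)}" if "i < n" for i
  proof -
    have "mends T (es ! i) = ends (es ! i)"
      using T in_F [OF that] by (auto simp: represents_def)
    then show ?thesis using en [OF that] by simp
  qed
  let ?e = "es ! (n - 1)"
  have path: "(us ! 0, us ! i) \<in> conn (F - {?e})" if "i < n" for i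
    using that
  proof (induction i)
    case 0
    show ?case by simp
  next
    case (Suc i)
    have "es ! i \<noteq> ?e" using n Suc.prems by (simp add: nth_eq_iff_index_eq)
    then have "es ! i \<in> F - {?e}" using in_F [of i] Suc.prems by simp
    moreover have "ends (es ! i) = {us ! i, us ! Suc i}" using en' [of i] Suc.prems by simp
    ultimately have "(us ! i, us ! Suc i) \<in> conn (F - {?e})" by (rule conn_edge)
    then show ?case using Suc.IH Suc.prems conn_trans by (meson Suc_lessD)
  qed
  have "ends ?e = {us ! 0, us ! (n - 1)}" using en' [of "n - 1"] n(1) by (simp add: insert_commute)
  moreover have "?e \<in> F" "(us ! 0, us ! (n - 1)) \<in> conn (F - {?e})"
    using in_F [of "n - 1"] path [of "n - 1"] n(1) by simp_all
  ultimately show False using F unfolding forest_def by blast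
qed

text \<open>From given spanning trees only connectedness is kept; conversely
  \<open>tcon_packing\<close> thins connected sets to forests, which contain no cycle.\<close>

lemma tree_connected_iff:
  assumes T: "represents T X A"
  shows "tree_connected m T \<longleftrightarrow> tcon X A"
proof
  have medges: "medges T = A" and XV: "X \<subseteq> V" and AE: "A \<subseteq> E"
    using T by (auto simp: represents_def)
  show "tcon X A" if tc: "tree_connected m T"
  proof -
    obtain F where F: "\<forall>i < m. F i \<subseteq> A \<and> mtree (edge_factor T (F i))" "edge_disjoint F"
      using tc unfolding tree_connected_def medges edge_disjoint_def by (elim exE conjE)
    have sub: "F i \<subseteq> A" if "i < m" for i using F(1) that by simp
    have sp: "X \<noteq> {} \<and> spans X (F i)" if "i < m" for i
      using spans_iff_mconnected [OF T sub [OF that]] F(1) that by (simp add: mtree_def)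
    \<comment> \<open>As \<open>m > 0\<close>, there is at least one tree, and trees have a
      vertex.\<close>
    then have "X \<noteq> {}" using m_pos by blast
    then show ?thesis using F(2) sub sp XV by (intro tconI [of X F]) auto
  qed
  show "tree_connected m T" if t: "tcon X A"
  proof -
    obtain F where F: "packing X A F" by (rule tcon_packing [OF t AE])
    have "mtree (edge_factor T (F i))" if "i < m" for i
      unfolding mtree_def
      using spans_iff_mconnected [OF T packingD(1) [OF F that]] tcon_V(1) [OF t]
        packingD(2) [OF F that] forest_no_mcycle [OF T packingD(1) [OF F that] packingD(3) [OF F that]] by simp
    then show ?thesis
      unfolding tree_connected_def medges
      using packingD(1,4) [OF F] by (intro exI [of _ F]) (simp add: edge_disjoint_def)
  qed
qed

text \<open>If no edge can be deleted, a packing of \<open>m\<close> trees covers all edges, which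
  fixes their number. Conversely, one edge fewer is too few for \<open>m\<close> trees.\<close>

lemma minimally_tree_connected_iff:
  assumes T: "represents T X A"
  shows "minimally_tree_connected m T \<longleftrightarrow> mtcon X A"
proof -
  have medges: "medges T = A" and XV: "X \<subseteq> V" and AE: "A \<subseteq> E" and AX: "\<forall>e \<in> A. ends e \<subseteq> X"
    using T by (auto simp: represents_def)
  have "represents (mdelete_edge T e) X (A - {e})" for e
    using T by (auto simp: represents_def mdelete_edge_def edge_factor_def)
  then have del: "tree_connected m (mdelete_edge T e) \<longleftrightarrow> tcon X (A - {e})" for e
    by (rule tree_connected_iff)
  show ?thesis
    unfolding minimally_tree_connected_def tree_connected_iff [OF T] del medges
  proof
    assume t: "tcon X A \<and> (\<forall>e \<in> A. \<not> tcon X (A - {e}))"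
    obtain F where F: "packing X A F" using t by (auto intro: tcon_packing [OF _ AE])
    have "A \<subseteq> (\<Union>i<m. F i)"
    proof
      fix e assume e: "e \<in> A"
      show "e \<in> (\<Union>i<m. F i)"
      proof (rule ccontr)
        assume not: "e \<notin> (\<Union>i<m. F i)"
        have "tcon X (A - {e})"
        proof (rule tconI [of X F])
          show "F i \<subseteq> A - {e}" if "i < m" for i
            using packingD(1) [OF F that] not that by blast
          show "X \<noteq> {}" using t tcon_V(1) by blast
        qed (use packingD [OF F] XV in auto)
        then show False using t e by blast
      qed
    qed
    moreover have "(\<Union>i<m. F i) \<subseteq> A" using packingD(1) [OF F] by blast
    ultimately have "A = (\<Union>i<m. F i)" by (rule subset_antisym)
    then have "card A = card (\<Union>i<m. F i)" by (rule arg_cong)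
    also have "\<dots> = m * (card X - 1)" using t tcon_V(1) by (intro card_packing [OF F AE _ XV]) blast
    finally show "mtcon X A" using t AE AX by (simp add: mtcon_def)
  next
    assume mt: "mtcon X A"
    have "\<not> tcon X (A - {e})" if "e \<in> A" for e
    proof
      assume "tcon X (A - {e})"
      then have "m * (card X - 1) \<le> card (ind (A - {e}) X)"
        using AE by (intro tcon_card_ge) auto
      also have "\<dots> \<le> card (A - {e})"
        using AE by (intro card_mono finite_sub_E ind_subset) auto
      also have "\<dots> < card A"
        using that by (intro card_Diff1_less finite_sub_E AE)
      finally show False using mt by (simp add: mtcon_def)
    qed
    then show "tcon X A \<and> (\<forall>e \<in> A. \<not> tcon X (A - {e}))" using mt by (simp add: mtcon_def)
  qed
qed

lemma tree_components_delete:
  assumes T: "represents T V A"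
  shows "tree_components m (mdelete_verts T S) = components A (V - S)"
proof -
  have verts: "mverts (mdelete_verts T S) = V - S"
    using T by (simp add: represents_def mdelete_verts_def minduced_def)
  have "tree_connected m (minduced (mdelete_verts T S) X) \<longleftrightarrow> tcon X A" if "X \<subseteq> V - S" for X
  proof -
    have "represents (minduced (mdelete_verts T S) X) X (ind A X)"
      using T that by (auto simp: represents_def mdelete_verts_def minduced_def ind_def)
    then have "tree_connected m (minduced (mdelete_verts T S) X) \<longleftrightarrow> tcon X (ind A X)"
      by (rule tree_connected_iff)
    then show ?thesis using tcon_ind tcon_mono [OF _ ind_subset] by blast
  qed
  then show ?thesis
    unfolding tree_components_def components_def verts by blast
qed

lemma crossing_edges_delete:
  assumes T: "represents T V A"
  shows "crossing_edges (mdelete_verts T S) P =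
    card {e \<in> ind A (V - S). \<exists>X \<in> P. \<exists>Y \<in> P. X \<noteq> Y \<and> ends e \<inter> X \<noteq> {} \<and> ends e \<inter> Y \<noteq> {}}"
proof -
  have "e \<in> medges (mdelete_verts T S) \<longleftrightarrow> e \<in> ind A (V - S)" for e
    using T by (auto simp: represents_def mdelete_verts_def minduced_def ind_def)
  moreover have "mends (mdelete_verts T S) e = ends e" if "e \<in> ind A (V - S)" for e
    using T that by (simp add: represents_def mdelete_verts_def minduced_def ind_def)
  ultimately show ?thesis
    unfolding crossing_edges_def by (intro arg_cong [where f = card] Collect_cong) (simp cong: conj_cong)
qed

lemma Omega_delete_eq:
  assumes G: "represents G V E" and H: "represents H V A"
    and same: "saturated A (V - S)"
  shows "Omega m (mdelete_verts G S) = Omega m (mdelete_verts H S)"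
proof -
  have AE: "A \<subseteq> E" using H by (simp add: represents_def)
  let ?P = "components A (V - S)"
  have P: "tree_components m (mdelete_verts G S) = ?P" "tree_components m (mdelete_verts H S) = ?P"
    unfolding tree_components_delete [OF G] tree_components_delete [OF H]
    using components_same [OF Diff_subset AE same] by auto
  have "{e \<in> ind E (V - S). \<exists>X \<in> ?P. \<exists>Y \<in> ?P. X \<noteq> Y \<and> ends e \<inter> X \<noteq> {} \<and> ends e \<inter> Y \<noteq> {}}
      = {e \<in> ind A (V - S). \<exists>X \<in> ?P. \<exists>Y \<in> ?P. X \<noteq> Y \<and> ends e \<inter> X \<noteq> {} \<and> ends e \<inter> Y \<noteq> {}}"
  proof (intro equalityI subsetI)
    fix e assume "e \<in> {e \<in> ind E (V - S). \<exists>X \<in> ?P. \<exists>Y \<in> ?P. X \<noteq> Y \<and> ends e \<inter> X \<noteq> {} \<and> ends e \<inter> Y \<noteq> {}}"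
    then obtain X Y where e: "e \<in> E" "ends e \<subseteq> V - S" and X: "X \<in> ?P" "ends e \<inter> X \<noteq> {}"
      and Y: "Y \<in> ?P" "ends e \<inter> Y \<noteq> {}" and XY: "X \<noteq> Y"
      by (auto simp: ind_def)
    have "e \<in> A" using crossing_same [OF Diff_subset AE same e X Y XY] .
    then have "e \<in> ind A (V - S)" using e(2) by (simp add: ind_def)
    then show "e \<in> {e \<in> ind A (V - S). \<exists>X \<in> ?P. \<exists>Y \<in> ?P. X \<noteq> Y \<and> ends e \<inter> X \<noteq> {} \<and> ends e \<inter> Y \<noteq> {}}"
      using X Y XY by blast
  qed (use AE in \<open>auto simp: ind_def\<close>)
  then have "crossing_edges (mdelete_verts G S) ?P = crossing_edges (mdelete_verts H S) ?P"
    unfolding crossing_edges_delete [OF G] crossing_edges_delete [OF H] by (rule arg_cong)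
  then show ?thesis by (simp add: Omega_def P)
qed

end

section \<open>Reduction of the theorem to vertex and edge sets\<close>

theorem theorem3p1:
  fixes m :: nat and G M H :: "('v, 'e) mgraph" and h :: "'v \<Rightarrow> int"
  assumes "m > 0"
    and "multigraph G"
    and "tree_connected m G"
    and "mfactor M G"
    and "max_mdegree M \<le> m"
    and "mfactor H G"
    and "minimally_tree_connected m H"
    and "msubgraph M H"
    and "\<And>H' :: ('v, 'e) mgraph. \<lbrakk>mfactor H' G; minimally_tree_connected m H'; msubgraph M H'\<rbrakk>
           \<Longrightarrow> total_excess H h \<le> total_excess H' h"
  shows "\<exists>S \<subseteq> mverts G.
           Omega m (mdelete_verts G S) = Omega m (mdelete_verts H S) \<and>
           {v \<in> mverts G. int (mdegree H v) > h v} \<subseteq> S \<and>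
           (\<forall>v \<in> S. int (mdegree H v) \<ge> h v)"
proof -
  interpret tree_packing "mverts G" "medges G" "mends G" m
    using assms(1,2) by unfold_locales (auto simp: multigraph_def)
  have repG: "represents G (mverts G) (medges G)"
    using ends_V by (auto simp: represents_def)
  have repH: "represents H (mverts G) (medges H)"
  proof -
    have H: "mverts H = mverts G" "medges H \<subseteq> medges G" "\<forall>e \<in> medges H. mends H e = mends G e"
      using assms(6) unfolding mfactor_def msubgraph_def by blast+
    then have "\<forall>e \<in> medges H. mends G e \<subseteq> mverts G" using ends_V by blast
    with H show ?thesis by (simp add: represents_def)
  qed
  have mH: "mtcon (mverts G) (medges H)"
    using minimally_tree_connected_iff [OF repH] assms(7) by simp
  have degree: "mdegree K v = deg (medges K) v" if "mfactor K G" for K v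
  proof -
    have "{e \<in> medges K. v \<in> mends K e} = {e \<in> medges K. v \<in> mends G e}"
      using that by (auto simp: mfactor_def msubgraph_def)
    then show ?thesis by (simp add: mdegree_def deg_def)
  qed
  have excess: "total_excess K h = (\<Sum>v\<in>mverts G. max 0 (int (deg (medges K) v) - h v))"
    if "mfactor K G" for K
    using that by (simp add: total_excess_def degree [OF that]) (simp add: mfactor_def)
  have N: "medges M \<subseteq> medges H" using assms(8) by (simp add: msubgraph_def)
  have degM: "deg (medges M) v \<le> m" if "v \<in> mverts G" for v
  proof -
    have "mdegree M v \<le> max_mdegree M"
      unfolding max_mdegree_def using that assms(4) finite_V by (intro Max_ge) (auto simp: mfactor_def)
    then show ?thesis using assms(5) degree [OF assms(4)] by simp
  qed
  have min: "(\<Sum>v\<in>mverts G. max 0 (int (deg (medges H) v) - h v))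
      \<le> (\<Sum>v\<in>mverts G. max 0 (int (deg B v) - h v))"
    if B: "mtcon (mverts G) B" "medges M \<subseteq> B" for B
  proof -
    \<comment> \<open>A competing edge set becomes a factor of \<open>G\<close>, to which the
      minimality of the total excess applies.\<close>
    let ?K = "edge_factor G B"
    have repK: "represents ?K (mverts G) B"
      using B(1) by (auto simp: represents_def edge_factor_def mtcon_def)
    have fK: "mfactor ?K G"
      using B(1) by (auto simp: mfactor_def msubgraph_def edge_factor_def mtcon_def)
    have "minimally_tree_connected m ?K"
      using minimally_tree_connected_iff [OF repK] B(1) by simp
    moreover have "msubgraph M ?K"
      using assms(4) B(2) unfolding mfactor_def msubgraph_def edge_factor_def by simp metis
    ultimately have "total_excess H h \<le> total_excess ?K h" using assms(9) fK by blast
    then show ?thesis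
      unfolding excess [OF assms(6)] excess [OF fK] by (simp add: edge_factor_def)
  qed
  obtain S where S: "S \<subseteq> mverts G" "{v \<in> mverts G. h v < int (deg (medges H) v)} \<subseteq> S"
    "\<forall>v \<in> S. h v \<le> int (deg (medges H) v)"
    and same: "saturated (medges H) (mverts G - S)"
    by (rule good_vertex_set [OF mH N degM min])
  have "Omega m (mdelete_verts G S) = Omega m (mdelete_verts H S)"
    by (rule Omega_delete_eq [OF repG repH same])
  then show ?thesis using S unfolding degree [OF assms(6)] by blast
qed

end
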